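(* Suppose that there exist points $a_1,a_2,b$ with $0<a_1\le a_2<b<1$ such that (i) $f_1$ is convex on $[0,a_1]$, concave on $[a_1,a_2]$ and convex on $[a_2,1]$; (ii) $f_2$ is convex on $[0,b]$ and concave on $[b,1]$. Then: (a) there exists $s^*=(\ell^1,\ell^2,r)\in\hat{\mathcal C}$ with $$\hat U_i(s^* )=\sup_{(s_i,s_{-i}^* )\in\hat{\mathcal C}}\hat U_i(s_i,s_{-i}^* ),\qquad i\in\{1,2,3\};\qquad(\ast)$$ (b) a solution $s^*=(\ell^1,\ell^2,r)\in\hat{\mathcal C}$ to $(\ast)$ satisfies $\hat U_2(s^* )\ge0$ if and only if $(D_{[\ell^1,\ell^2]},D_{[r,1]})$ is a Nash equilibrium for the Dynkin problem (DP).
   Context: Process. Let $W=(W_t)_{t\ge0}$ be a one-dimensional standard Brownian motion on a filtered probability space with universally completed filtration $\mathbb F=(\mathcal F_t)_{t\ge0}$. Let $E=(0,1)$, $\zeta=\inf\{t\ge0: W_t\notin E\}$, and let $X_t=W_t$ for $0\le t<\zeta$ and $X_t=\Delta$ for $t\ge\zeta$ (including $t=\infty$), where $\Delta$ is a cemetery state. $\mathbb P^x,\mathbb E^x$ denote probability and expectation when the process starts at $x$. Every function $\phi$ is extended by $\phi(\Delta)=0$. $\mathcal T$ is the set of $\mathbb F$-stopping times with values in $[0,\infty]$. For a measurable set $A$, $D_A=\inf\{t\ge0: X_t\in A\}$ with $\inf\emptyset=\zeta$, and $g_{i,A}(x)=\mathbb E^x[g_i(X_{D_A})]$. Rewards.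 For $i=1,2$, $f_i,g_i,h_i$ are bounded continuous real functions on $[0,1]$ with $f_i\le h_i\le g_i$, vanishing at $0$ and $1$ (and at $\Delta$). Game (DP). Writing $-i$ for the player other than $i$ ($i\in\{1,2\}$), for $\tau_1,\tau_2\in\mathcal T$, $$M_i^x(\tau_1,\tau_2)=\mathbb E^x\big[f_i(X_{\tau_i})1_{\{\tau_i<\tau_{-i}\}}+g_i(X_{\tau_{-i}})1_{\{\tau_{-i}<\tau_i\}}+h_i(X_{\tau_i})1_{\{\tau_i=\tau_{-i}\}}\big].$$ A pair $(\tau_1^*,\tau_2^* )\in\mathcal T\times\mathcal T$ is a Nash equilibrium for the DP if for every $x\in E$, $M_1^x(\tau_1^*,\tau_2^* )=\sup_{\tau_1\in\mathcal T}M_1^x(\tau_1,\tau_2^* )$ and $M_2^x(\tau_1^*,\tau_2^* )=\sup_{\tau_2\in\mathcal T}M_2^x(\tau_1^*,\tau_2)$. Three-player generalised game. Let $\hat{\mathcal C}=\{(x,y,z)\in[a_1,a_2]\times[a_1,a_2]\times[b,1]: x\le y\}$ and $$\hat U_1(x,y,z)=\frac{f_1(x)-g_{1,[z,1]}(x)}{x},\quad \hat U_2(x,y,z)=\frac{f_1(y)-g_{1,[z,1]}(y)}{z-y},\quad \hat U_3(x,y,z)=\frac{f_2(z)-g_{2,[0,y]}(z)}{z-y},$$ with $\hat U_2=\hat U_3=-\infty$ if $y\ge z$. Explicitly, $g_{1,[z,1]}(x)=g_1(z)\frac{x}{z}$ for $x<z$ and $g_{2,[0,y]}(z)=g_2(y)\frac{1-z}{1-y}$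 for $y<z$. For $s\in\mathbb R^3$, $(w,s_{-i})$ denotes the vector $s$ with its $i$-th entry replaced by $w$. *)

theory Defs
  imports "HOL-Probability.Probability"
begin

section \<open>Brownian motion started at an arbitrary point\<close>

text \<open>
  \<open>M\<close> carries the raw \<open>\<sigma>\<close>-algebra, \<open>G\<close> is the filtration before completion and \<open>P x\<close> is the law
  under which the process starts at \<open>x\<close>. Filtrations are indexed by \<^typ>\<open>ennreal\<close>, i.e. by
  \<open>[0,\<infinity>]\<close>, so that \<^const>\<open>stopping_time\<close> speaks about times with values in \<open>[0,\<infinity>]\<close>; its condition
  at \<open>\<infinity>\<close> is void, hence \<open>G \<infinity>\<close> is irrelevant. The process \<open>W\<close> is only considered at real times
  \<open>t \<ge> 0\<close>. The kernel property of \<open>P\<close> is what makes the laws \<open>P\<^sup>\<mu>\<close> of \<open>universal_completion\<close> below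
  meaningful.
\<close>

locale brownian_motion_family = filtration "space M" G
  for M :: "'a measure" and G :: "ennreal \<Rightarrow> 'a measure" +
  fixes P :: "real \<Rightarrow> 'a measure" and W :: "real \<Rightarrow> 'a \<Rightarrow> real"
  assumes subalgebra_G: "\<And>t. subalgebra M (G t)"
    and kernel: "P \<in> borel \<rightarrow>\<^sub>M prob_algebra M"
    and adapted: "\<And>t. 0 \<le> t \<Longrightarrow> W t \<in> borel_measurable (G (ennreal t))"
    and start: "\<And>x. AE \<omega> in P x. W 0 \<omega> = x"
    and continuous_paths: "\<And>\<omega>. \<omega> \<in> space M \<Longrightarrow> continuous_on {0..} (\<lambda>t. W t \<omega>)"
    and gaussian_increments: "\<And>x s t. 0 \<le> s \<Longrightarrow> s < t \<Longrightarrow>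
      distributed (P x) lborel (\<lambda>\<omega>. W t \<omega> - W s \<omega>) (normal_density 0 (sqrt (t - s)))"
    and independent_increments: "\<And>x s t. 0 \<le> s \<Longrightarrow> s < t \<Longrightarrow>
      prob_space.indep_set (P x) (sets (G (ennreal s)))
        (sets (vimage_algebra (space M) (\<lambda>\<omega>. W t \<omega> - W s \<omega>) borel))"

text \<open>
  The universal completion of \<open>G\<close>: the intersection, over all initial distributions \<open>\<mu>\<close>, of the
  augmentations of \<open>G\<close> by the null sets of \<open>P\<^sup>\<mu> = \<integral> P\<^sup>x \<mu>(dx)\<close>, which is \<open>\<mu> \<bind> P\<close>. The collection
  below is already a \<open>\<sigma>\<close>-algebra; \<^const>\<open>sigma\<close> only turns it into a measurable space.
\<close>

definition universal_completion ::
    "'a measure \<Rightarrow> (real \<Rightarrow> 'a measure) \<Rightarrow> 'a measure \<Rightarrow> 'a measure" where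
  "universal_completion M P G = sigma (space M)
     {A. A \<subseteq> space M \<and>
         (\<forall>\<mu> \<in> space (prob_algebra (borel :: real measure)).
            \<exists>B \<in> sets G. sym_diff A B \<in> null_sets (completion (\<mu> \<bind> P)))}"

definition stopping_times ::
    "'a measure \<Rightarrow> (ennreal \<Rightarrow> 'a measure) \<Rightarrow> (real \<Rightarrow> 'a measure) \<Rightarrow> ('a \<Rightarrow> ennreal) set" where
  "stopping_times M G P = {\<tau>. stopping_time (\<lambda>t. universal_completion M P (G t)) \<tau>}"

section \<open>The process killed on leaving the unit interval\<close>

definition exit_time :: "(real \<Rightarrow> 'a \<Rightarrow> real) \<Rightarrow> 'a \<Rightarrow> ennreal" where
  "exit_time W \<omega> = Inf (ennreal ` {t. 0 \<le> t \<and> W t \<omega> \<notin> {0<..<1}})"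

text \<open>\<^const>\<open>None\<close> is the cemetery state.\<close>

definition killed :: "(real \<Rightarrow> 'a \<Rightarrow> real) \<Rightarrow> ennreal \<Rightarrow> 'a \<Rightarrow> real option" where
  "killed W t \<omega> = (if t < exit_time W \<omega> then Some (W (enn2real t) \<omega>) else None)"

definition ext_cemetery :: "(real \<Rightarrow> real) \<Rightarrow> real option \<Rightarrow> real" where
  "ext_cemetery \<phi> = case_option 0 \<phi>"

definition hitting_time :: "(real \<Rightarrow> 'a \<Rightarrow> real) \<Rightarrow> real set \<Rightarrow> 'a \<Rightarrow> ennreal" where
  "hitting_time W A \<omega> =
     (let S = {t. killed W t \<omega> \<in> Some ` A} in if S = {} then exit_time W \<omega> else Inf S)"

text \<open>
  Expectations are taken under the completed laws: functionals of stopping times of the completed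
  filtration need not be measurable for the raw \<open>\<sigma>\<close>-algebra.
\<close>

definition expect :: "(real \<Rightarrow> 'a measure) \<Rightarrow> real \<Rightarrow> ('a \<Rightarrow> real) \<Rightarrow> real" where
  "expect P x Y = integral\<^sup>L (completion (P x)) Y"

definition hitting_reward ::
    "(real \<Rightarrow> 'a measure) \<Rightarrow> (real \<Rightarrow> 'a \<Rightarrow> real) \<Rightarrow> (real \<Rightarrow> real) \<Rightarrow> real set \<Rightarrow> real \<Rightarrow> real" where
  "hitting_reward P W g A x =
     expect P x (\<lambda>\<omega>. ext_cemetery g (killed W (hitting_time W A \<omega>) \<omega>))"

section \<open>The Dynkin game\<close>

definition admissible_rewards ::
    "(real \<Rightarrow> real) \<Rightarrow> (real \<Rightarrow> real) \<Rightarrow> (real \<Rightarrow> real) \<Rightarrow> bool" where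
  "admissible_rewards f g h \<longleftrightarrow>
     (\<forall>\<phi> \<in> {f, g, h}. continuous_on {0..1} \<phi> \<and> \<phi> 0 = 0 \<and> \<phi> 1 = 0) \<and>
     (\<forall>x \<in> {0..1}. f x \<le> h x \<and> h x \<le> g x)"

text \<open>
  The payoff of a player with rewards \<open>f, g, h\<close> who stops at \<open>\<tau>\<close> while the opponent stops at \<open>\<sigma>\<close>.
\<close>

definition payoff ::
    "(real \<Rightarrow> 'a measure) \<Rightarrow> (real \<Rightarrow> 'a \<Rightarrow> real) \<Rightarrow>
     (real \<Rightarrow> real) \<Rightarrow> (real \<Rightarrow> real) \<Rightarrow> (real \<Rightarrow> real) \<Rightarrow>
     real \<Rightarrow> ('a \<Rightarrow> ennreal) \<Rightarrow> ('a \<Rightarrow> ennreal) \<Rightarrow> real" where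
  "payoff P W f g h x \<tau> \<sigma> = expect P x (\<lambda>\<omega>.
     if \<tau> \<omega> < \<sigma> \<omega> then ext_cemetery f (killed W (\<tau> \<omega>) \<omega>)
     else if \<sigma> \<omega> < \<tau> \<omega> then ext_cemetery g (killed W (\<sigma> \<omega>) \<omega>)
     else ext_cemetery h (killed W (\<tau> \<omega>) \<omega>))"

definition nash_equilibrium ::
    "'a measure \<Rightarrow> (ennreal \<Rightarrow> 'a measure) \<Rightarrow> (real \<Rightarrow> 'a measure) \<Rightarrow> (real \<Rightarrow> 'a \<Rightarrow> real) \<Rightarrow>
     (real \<Rightarrow> real) \<Rightarrow> (real \<Rightarrow> real) \<Rightarrow> (real \<Rightarrow> real) \<Rightarrow>
     (real \<Rightarrow> real) \<Rightarrow> (real \<Rightarrow> real) \<Rightarrow> (real \<Rightarrow> real) \<Rightarrow>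
     ('a \<Rightarrow> ennreal) \<times> ('a \<Rightarrow> ennreal) \<Rightarrow> bool" where
  "nash_equilibrium M G P W f\<^sub>1 g\<^sub>1 h\<^sub>1 f\<^sub>2 g\<^sub>2 h\<^sub>2 = (\<lambda>(\<tau>\<^sub>1, \<tau>\<^sub>2).
     \<tau>\<^sub>1 \<in> stopping_times M G P \<and> \<tau>\<^sub>2 \<in> stopping_times M G P \<and>
     (\<forall>x \<in> {0<..<1}.
        ereal (payoff P W f\<^sub>1 g\<^sub>1 h\<^sub>1 x \<tau>\<^sub>1 \<tau>\<^sub>2) =
          (SUP \<tau> \<in> stopping_times M G P. ereal (payoff P W f\<^sub>1 g\<^sub>1 h\<^sub>1 x \<tau> \<tau>\<^sub>2)) \<and>
        ereal (payoff P W f\<^sub>2 g\<^sub>2 h\<^sub>2 x \<tau>\<^sub>2 \<tau>\<^sub>1) =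
          (SUP \<tau> \<in> stopping_times M G P. ereal (payoff P W f\<^sub>2 g\<^sub>2 h\<^sub>2 x \<tau> \<tau>\<^sub>1))))"

section \<open>The three-player generalised game\<close>

definition strategies :: "real \<Rightarrow> real \<Rightarrow> real \<Rightarrow> (real ^ 3) set" where
  "strategies a\<^sub>1 a\<^sub>2 b =
     {s. s $ 1 \<in> {a\<^sub>1..a\<^sub>2} \<and> s $ 2 \<in> {a\<^sub>1..a\<^sub>2} \<and> s $ 3 \<in> {b..1} \<and> s $ 1 \<le> s $ 2}"

definition utility ::
    "(real \<Rightarrow> 'a measure) \<Rightarrow> (real \<Rightarrow> 'a \<Rightarrow> real) \<Rightarrow>
     (real \<Rightarrow> real) \<Rightarrow> (real \<Rightarrow> real) \<Rightarrow> (real \<Rightarrow> real) \<Rightarrow> (real \<Rightarrow> real) \<Rightarrow>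
     3 \<Rightarrow> real ^ 3 \<Rightarrow> ereal" where
  "utility P W f\<^sub>1 g\<^sub>1 f\<^sub>2 g\<^sub>2 i s =
     (let x = s $ 1; y = s $ 2; z = s $ 3 in
      if i = 1 then ereal ((f\<^sub>1 x - hitting_reward P W g\<^sub>1 {z..1} x) / x)
      else if y \<ge> z then - \<infinity>
      else if i = 2 then ereal ((f\<^sub>1 y - hitting_reward P W g\<^sub>1 {z..1} y) / (z - y))
      else ereal ((f\<^sub>2 z - hitting_reward P W g\<^sub>2 {0..y} z) / (z - y)))"

definition replace :: "real ^ 3 \<Rightarrow> 3 \<Rightarrow> real \<Rightarrow> real ^ 3" where
  "replace s i w = (\<chi> j. if j = i then w else s $ j)"

definition generalised_equilibrium ::
    "(real ^ 3) set \<Rightarrow> (3 \<Rightarrow> real ^ 3 \<Rightarrow> ereal) \<Rightarrow> real ^ 3 \<Rightarrow> bool" where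
  "generalised_equilibrium C U s \<longleftrightarrow>
     s \<in> C \<and> (\<forall>i. U i s = (SUP w \<in> {w. replace s i w \<in> C}. U i (replace s i w)))"

end

theory Submission
  imports Defs
begin

text \<open>
  A hitting time \<open>D\<^sub>A\<close> of a closed set is the first entry time of \<open>W\<close> into \<open>A \<union> - {0<..<1}\<close>, and the
  stopped rewards are functions of \<open>W\<close> at time \<open>\<sigma> = min \<tau> D\<^sub>A\<close>. Since \<open>E\<^sup>x W\<^sub>\<sigma> = x\<close>, an affine function
  that dominates the rewards of a player on the component of \<open>x\<close> bounds every payoff from \<open>x\<close>, with
  equality if it agrees with the rewards at the points where the game ends. Such majorants come from
  the optimality of \<open>\<ell>\<^sup>1\<close>, \<open>\<ell>\<^sup>2\<close> and \<open>r\<close> together with the convexity assumptions;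
  \<open>U\<^sub>2 \<ge> 0\<close> says that at \<open>\<ell>\<^sup>2\<close> stopping is at least as good as never stopping.

  For existence, let \<open>\<ell>\<^sup>1\<close> maximise \<open>f\<^sub>1 x / x\<close> on all of \<open>{a\<^sub>1..a\<^sub>2}\<close>. What remains is a game of two players
  on intervals whose utilities are ratios of a concave and an affine function. Subtracting \<open>\<epsilon> y\<^sup>2\<close> from
  the numerators makes the best responses unique, hence continuous, so that Brouwer's theorem applies;
  then \<open>\<epsilon> \<rightarrow> 0\<close>.
\<close>

section \<open>First entry times of continuous paths\<close>

text \<open>The constraint \<open>x \<le> y\<close> couples the feasible sets of the first two
  players. It causes no trouble because the first utility is \<open>f\<^sub>1 x / x\<close> minus a
  term free of \<open>x\<close>: a maximiser over \<open>{a\<^sub>1..a\<^sub>2}\<close> stays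
  optimal on every \<open>{a\<^sub>1..y}\<close> containing it, and the second player is left with
  the fixed interval from it to \<open>a\<^sub>2\<close>. The maximisers of a ratio of a concave and
  an affine function may fill an interval; the strictly concave perturbation avoids fixed points of
  set-valued maps.

  For the majorants, optimality compares a boundary only with points of the concave stretch of a
  reward. On a convex stretch it is enough to have a line above the reward at both ends, and these
  are controlled by optimality, by the zeros at 0 and 1, or by \<open>f \<le> g\<close>.

  On the probabilistic side, a deviating player may use any stopping time of the completed
  filtration. So the mean of \<open>W\<close> at \<sigma> has to be known for every stopping time
  \<sigma> below the exit time, not only for hitting times; this is why a full optional stopping
  result is derived, by putting time on a grid and truncating the horizon.\<close>

definition absorbing :: "real set \<Rightarrow> real set" where
  "absorbing A = A \<union> - {0<..<1}"

lemma closed_absorbing: "closed A \<Longrightarrow> closed (absorbing A)"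
  unfolding absorbing_def by (intro closed_Un closed_Compl) auto

lemma first_entry_exists:
  fixes w :: "real \<Rightarrow> real"
  assumes "continuous_on {0..} w" "closed C" "0 \<le> t" "w t \<in> C"
  obtains t0 where "0 \<le> t0" "w t0 \<in> C" "\<And>s. 0 \<le> s \<Longrightarrow> w s \<in> C \<Longrightarrow> t0 \<le> s"
proof -
  let ?R = "{0..} \<inter> w -` C"
  have "closed ?R" using assms by (intro continuous_closed_preimage) auto
  moreover have "bdd_below ?R" by (intro bdd_belowI[of _ 0]) auto
  moreover have "?R \<noteq> {}" using assms by auto
  ultimately have "Inf ?R \<in> ?R" by (metis closed_contains_Inf)
  moreover have "Inf ?R \<le> s" if "0 \<le> s" "w s \<in> C" for s
    using that \<open>bdd_below ?R\<close> by (intro cInf_lower) auto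
  ultimately show thesis using that[of "Inf ?R"] by auto
qed

lemma Inf_ennreal_image_eq:
  assumes "0 \<le> t0" "t0 \<in> R" "\<And>s. s \<in> R \<Longrightarrow> t0 \<le> s"
  shows "Inf (ennreal ` R) = ennreal t0"
  using assms by (intro antisym Inf_greatest Inf_lower) (auto intro: ennreal_leI)

lemma hitting_time_eq_top:
  assumes "\<And>s. 0 \<le> s \<Longrightarrow> W s \<omega> \<notin> absorbing A"
  shows "hitting_time W A \<omega> = \<infinity>"
proof -
  have "{t. 0 \<le> t \<and> W t \<omega> \<notin> {0<..<1}} = {}" using assms by (auto simp: absorbing_def)
  then have "exit_time W \<omega> = \<infinity>" unfolding exit_time_def by (metis image_empty Inf_empty infinity_ennreal_def)
  moreover have "{t. killed W t \<omega> \<in> Some ` A} = {}"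
    using assms[OF enn2real_nonneg] by (auto simp: killed_def absorbing_def)
  ultimately show ?thesis by (simp add: hitting_time_def)
qed

text \<open>The convention that the infimum of the empty set is the exit time is what turns
  \<open>hitting_time\<close> into an entry time of \<open>absorbing A\<close>. If the first entry
  lies outside the unit interval, the process is killed before it meets \<open>A\<close>, and the
  convention returns the exit time, which is \<open>t0\<close>. Otherwise the process is still alive
  at \<open>t0\<close>, and the infimum is attained there.\<close>

lemma hitting_time_eq_first_entry:
  assumes t0: "0 \<le> t0" "W t0 \<omega> \<in> absorbing A"
    and first: "\<And>s. 0 \<le> s \<Longrightarrow> W s \<omega> \<in> absorbing A \<Longrightarrow> t0 \<le> s"
    and cont: "continuous_on {0..} (\<lambda>t. W t \<omega>)"
  shows "hitting_time W A \<omega> = ennreal t0"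
proof (cases "W t0 \<omega> \<in> {0<..<1}")
  case False
  have \<zeta>: "exit_time W \<omega> = ennreal t0" unfolding exit_time_def
    by (rule Inf_ennreal_image_eq) (use t0 False first in \<open>auto simp: absorbing_def\<close>)
  have "{t. killed W t \<omega> \<in> Some ` A} = {}"
  proof (safe, goal_cases)
    case (1 t)
    then have "t < ennreal t0" "W (enn2real t) \<omega> \<in> A"
      by (auto simp: killed_def \<zeta> split: if_splits)
    moreover from this have "t0 \<le> enn2real t" by (intro first) (auto simp: absorbing_def)
    ultimately show ?case using t0
      by (metis ennreal_enn2real ennreal_leI ennreal_less_top leD order_less_trans)
  qed
  then show ?thesis using \<zeta> by (simp add: hitting_time_def)
next
  case True
  \<comment> \<open>An exit position lies outside the open unit interval, while the position at
    \<open>t0\<close> is inside; so the exit cannot happen at \<open>t0\<close>, nor earlier, since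
    exits are entries into \<open>absorbing A\<close>.\<close>
  have "ennreal t0 < exit_time W \<omega>"
  proof (cases "\<exists>t\<ge>0. W t \<omega> \<in> - {0<..<1}")
    case e: True
    then obtain t1 where t1: "0 \<le> t1" "W t1 \<omega> \<in> - {0<..<1}"
        "\<And>s. 0 \<le> s \<Longrightarrow> W s \<omega> \<in> - {0<..<1} \<Longrightarrow> t1 \<le> s"
      using first_entry_exists[OF cont, of "- {0<..<1}"] by (metis closed_Compl open_greaterThanLessThan)
    have "exit_time W \<omega> = ennreal t1" unfolding exit_time_def
      by (rule Inf_ennreal_image_eq) (use t1 in auto)
    moreover have "t0 \<le> t1" "t0 \<noteq> t1" using first[OF t1(1)] t1 True by (auto simp: absorbing_def)
    ultimately show ?thesis using t0 by (simp add: ennreal_less_iff)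
  next
    case e: False
    then have "{t. 0 \<le> t \<and> W t \<omega> \<notin> {0<..<1}} = {}" by auto
    then show ?thesis unfolding exit_time_def by (metis image_empty Inf_empty ennreal_less_top)
  qed
  then have mem: "killed W (ennreal t0) \<omega> \<in> Some ` A"
    using t0 True by (auto simp: killed_def absorbing_def)
  have "Inf {t. killed W t \<omega> \<in> Some ` A} = ennreal t0"
  proof (intro antisym Inf_greatest)
    fix t assume "t \<in> {t. killed W t \<omega> \<in> Some ` A}"
    then have "t < exit_time W \<omega>" "W (enn2real t) \<omega> \<in> A"
      by (auto simp: killed_def split: if_splits)
    moreover from this have "t0 \<le> enn2real t" by (intro first) (auto simp: absorbing_def)
    ultimately show "ennreal t0 \<le> t"
      by (metis ennreal_enn2real ennreal_leI order_less_le_trans top_greatest less_le)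
  qed (use mem in \<open>auto intro: Inf_lower\<close>)
  then show ?thesis using mem unfolding hitting_time_def Let_def by auto
qed

context
  fixes W :: "real \<Rightarrow> 'a \<Rightarrow> real" and \<omega> :: 'a
  assumes cont: "continuous_on {0..} (\<lambda>t. W t \<omega>)"
begin

lemma hitting_time_cases:
  assumes "closed A"
  obtains (never) "hitting_time W A \<omega> = \<infinity>" "\<And>s. 0 \<le> s \<Longrightarrow> W s \<omega> \<notin> absorbing A"
  | (first) t0 where "0 \<le> t0" "hitting_time W A \<omega> = ennreal t0" "W t0 \<omega> \<in> absorbing A"
      "\<And>s. 0 \<le> s \<Longrightarrow> W s \<omega> \<in> absorbing A \<Longrightarrow> t0 \<le> s"
proof (cases "\<exists>s\<ge>0. W s \<omega> \<in> absorbing A")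
  case True
  then obtain t0 where t0: "0 \<le> t0" "W t0 \<omega> \<in> absorbing A"
      "\<And>s. 0 \<le> s \<Longrightarrow> W s \<omega> \<in> absorbing A \<Longrightarrow> t0 \<le> s"
    using first_entry_exists[OF cont closed_absorbing[OF assms(1)]] by metis
  then show ?thesis using first(1)[OF t0(1) hitting_time_eq_first_entry[where W=W and \<omega>=\<omega>, OF t0 cont]] by blast
next
  case False
  then show ?thesis using hitting_time_eq_top[of W \<omega> A] never by blast
qed

text \<open>The set is closed and the path continuous, so the infimum is a minimum. Hence the weak
  inequality depends only on positions up to time \<open>t\<close>, and hitting times are stopping
  times without enlarging the filtration to the right.\<close>

lemma hitting_time_le_iff:
  assumes "closed A" "0 \<le> t"
  shows "hitting_time W A \<omega> \<le> ennreal t \<longleftrightarrow> (\<exists>s\<in>{0..t}. W s \<omega> \<in> absorbing A)"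
  using assms(1)
proof (cases rule: hitting_time_cases)
  case never
  then show ?thesis by (auto simp: top_unique)
next
  case (first t0)
  then show ?thesis using assms(2) by force
qed

text \<open>Everything shown for hitting times thereby covers the exit time. In the game,
  \<open>hitting_time W {}\<close> is the strategy of never stopping.\<close>

lemma exit_time_eq_hitting_time: "exit_time W = hitting_time W {}"
  by (auto simp: hitting_time_def)

lemma hitting_time_antimono:
  assumes "closed A" "closed B" "A \<subseteq> B"
  shows "hitting_time W B \<omega> \<le> hitting_time W A \<omega>"
  using assms(1)
proof (cases rule: hitting_time_cases)
  case (first t0)
  have "W t0 \<omega> \<in> absorbing B" using first(3) assms(3) by (auto simp: absorbing_def)
  then show ?thesis unfolding first(2) hitting_time_le_iff[OF assms(2) first(1)] using first(1) by auto
qed simp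

lemma hitting_time_le_exit_time:
  assumes "closed A"
  shows "hitting_time W A \<omega> \<le> exit_time W \<omega>"
  unfolding exit_time_eq_hitting_time by (rule hitting_time_antimono) (use assms in auto)

text \<open>When both players use hitting times, the game ends at the minimum of the two; this
  identifies that minimum as a single hitting time, whose location is known.\<close>

lemma hitting_time_Un:
  assumes "closed A" "closed B"
  shows "hitting_time W (A \<union> B) \<omega> = min (hitting_time W A \<omega>) (hitting_time W B \<omega>)"
proof (rule antisym)
  show "hitting_time W (A \<union> B) \<omega> \<le> min (hitting_time W A \<omega>) (hitting_time W B \<omega>)"
    using assms by (auto intro!: hitting_time_antimono)
  have "closed (A \<union> B)" using assms by auto
  from this show "min (hitting_time W A \<omega>) (hitting_time W B \<omega>) \<le> hitting_time W (A \<union> B) \<omega>"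
  proof (cases rule: hitting_time_cases)
    case (first t0)
    then have "W t0 \<omega> \<in> absorbing A \<or> W t0 \<omega> \<in> absorbing B" by (auto simp: absorbing_def)
    then have "hitting_time W A \<omega> \<le> ennreal t0 \<or> hitting_time W B \<omega> \<le> ennreal t0"
      unfolding hitting_time_le_iff[OF assms(1) first(1)] hitting_time_le_iff[OF assms(2) first(1)]
      using first(1) by auto
    then show ?thesis unfolding first(2) min_le_iff_disj .
  qed simp
qed

text \<open>The hypotheses below allow the degenerate interval \<open>\<alpha> = \<beta>\<close>, where the hitting time is \<open>0\<close>.\<close>

lemma hitting_time_location:
  assumes A: "closed A"
    and start: "\<alpha> \<le> W 0 \<omega>" "W 0 \<omega> \<le> \<beta>"
    and ends: "\<alpha> \<in> absorbing A" "\<beta> \<in> absorbing A" "absorbing A \<inter> {\<alpha><..<\<beta>} = {}"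
  shows "0 \<le> t \<Longrightarrow> ennreal t < hitting_time W A \<omega> \<Longrightarrow> W t \<omega> \<in> {\<alpha><..<\<beta>}"
    and "0 \<le> t \<Longrightarrow> ennreal t = hitting_time W A \<omega> \<Longrightarrow> W t \<omega> \<in> {\<alpha>, \<beta>}"
proof -
  have inside: "W t \<omega> \<in> {\<alpha><..<\<beta>}" if t: "0 \<le> t" "ennreal t < hitting_time W A \<omega>" for t
  proof (rule ccontr)
    assume *: "W t \<omega> \<notin> {\<alpha><..<\<beta>}"
    have c: "continuous_on {0..t} (\<lambda>t. W t \<omega>)" by (rule continuous_on_subset[OF cont]) auto
    \<comment> \<open>By the intermediate value theorem a path that has left the open interval has
      visited an end of it. Both ends are absorbing, so the hitting time would not exceed
      \<open>t\<close>.\<close>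
    have "\<exists>s\<in>{0..t}. W s \<omega> \<in> {\<alpha>, \<beta>}"
    proof (cases "W t \<omega> \<le> \<alpha>")
      case True
      then obtain s where "0 \<le> s" "s \<le> t" "W s \<omega> = \<alpha>"
        using IVT2'[of "\<lambda>t. W t \<omega>" t \<alpha> 0] start t c by auto
      then show ?thesis by auto
    next
      case False
      then obtain s where "0 \<le> s" "s \<le> t" "W s \<omega> = \<beta>"
        using IVT'[of "\<lambda>t. W t \<omega>" 0 \<beta> t] start t c * by auto
      then show ?thesis by auto
    qed
    then show False using hitting_time_le_iff[OF A t(1)] t(2) ends by (auto simp: not_le[symmetric])
  qed
  then show "0 \<le> t \<Longrightarrow> ennreal t < hitting_time W A \<omega> \<Longrightarrow> W t \<omega> \<in> {\<alpha><..<\<beta>}" .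
  assume t: "0 \<le> t" "ennreal t = hitting_time W A \<omega>"
  have abs: "W t \<omega> \<in> absorbing A"
    using A
  proof (cases rule: hitting_time_cases)
    case (first t0) then show ?thesis using t by simp
  qed (use t in auto)
  moreover have "W t \<omega> \<in> {\<alpha>..\<beta>}"
  proof (cases "t = 0")
    case False
    \<comment> \<open>At the hitting time itself the position is a limit of positions strictly
      inside, hence in the closed interval; being absorbing, it can only be an end.\<close>
    have "closure {0..<t} \<subseteq> {0..} \<inter> (\<lambda>t. W t \<omega>) -` {\<alpha>..\<beta>}"
    proof (rule closure_minimal)
      show "{0..<t} \<subseteq> {0..} \<inter> (\<lambda>t. W t \<omega>) -` {\<alpha>..\<beta>}"
      proof
        fix s assume "s \<in> {0..<t}"
        then have "W s \<omega> \<in> {\<alpha><..<\<beta>}" using inside[of s] unfolding t(2)[symmetric] by (simp add: ennreal_less_iff)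
        then show "s \<in> {0..} \<inter> (\<lambda>t. W t \<omega>) -` {\<alpha>..\<beta>}" using \<open>s \<in> {0..<t}\<close> by simp
      qed
      show "closed ({0..} \<inter> (\<lambda>t. W t \<omega>) -` {\<alpha>..\<beta>})"
        using cont by (intro continuous_closed_preimage) auto
    qed
    then show ?thesis using t False by auto
  qed (use start in auto)
  moreover have "W t \<omega> \<notin> {\<alpha><..<\<beta>}" using abs ends(3) by blast
  ultimately show "W t \<omega> \<in> {\<alpha>, \<beta>}" by auto
qed

lemma path_until_exit:
  assumes start: "W 0 \<omega> \<in> {0..1}" and t: "0 \<le> t"
  shows "ennreal t < exit_time W \<omega> \<Longrightarrow> W t \<omega> \<in> {0<..<1}"
    and "ennreal t = exit_time W \<omega> \<Longrightarrow> W t \<omega> \<in> {0, 1}"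
    and "ennreal t \<le> exit_time W \<omega> \<Longrightarrow> W t \<omega> \<in> {0..1}"
proof -
  have *: "0 \<in> absorbing {}" "1 \<in> absorbing {}" "absorbing {} \<inter> {0<..<1} = {}" "0 \<le> W 0 \<omega>" "W 0 \<omega> \<le> 1"
    using start by (auto simp: absorbing_def)
  note loc = hitting_time_location[OF closed_empty *(4,5,1,2,3) t, folded exit_time_eq_hitting_time]
  show "ennreal t < exit_time W \<omega> \<Longrightarrow> W t \<omega> \<in> {0<..<1}" "ennreal t = exit_time W \<omega> \<Longrightarrow> W t \<omega> \<in> {0, 1}"
    by (rule loc; assumption)+
  then show "ennreal t \<le> exit_time W \<omega> \<Longrightarrow> W t \<omega> \<in> {0..1}"
    unfolding le_less by fastforce
qed

text \<open>Up to and including the exit time the cemetery can be forgotten: at the exit the path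
  sits at 0 or 1, where \<phi> vanishes just as it does at the cemetery.\<close>

lemma ext_cemetery_killed:
  assumes start: "W 0 \<omega> \<in> {0..1}"
    and \<phi>: "\<phi> 0 = 0" "\<phi> 1 = 0" and t: "0 \<le> t" "ennreal t \<le> exit_time W \<omega>"
  shows "ext_cemetery \<phi> (killed W (ennreal t) \<omega>) = \<phi> (W t \<omega>)"
proof (cases "ennreal t < exit_time W \<omega>")
  case True
  then show ?thesis using t(1) by (simp add: killed_def ext_cemetery_def)
next
  case False
  then have "W t \<omega> \<in> {0, 1}" using t(2) by (intro path_until_exit(2)[OF start t(1)]) simp
  then show ?thesis using False \<phi> by (auto simp: killed_def ext_cemetery_def)
qed

end

section \<open>Universal completion and stopping times\<close>

context brownian_motion_family
begin

lemma prob_space_P: "prob_space (P x)"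
  and sets_P: "sets (P x) = sets M"
  and space_P: "space (P x) = space M"
proof -
  have "P x \<in> space (prob_algebra M)" using measurable_space[OF kernel, of x] by simp
  then show "prob_space (P x)" and *: "sets (P x) = sets M" by (auto simp: space_prob_algebra)
  show "space (P x) = space M" by (rule sets_eq_imp_space_eq[OF *])
qed

lemma measurable_G_mono: "f \<in> G s \<rightarrow>\<^sub>M N \<Longrightarrow> s \<le> t \<Longrightarrow> f \<in> G t \<rightarrow>\<^sub>M N"
  unfolding measurable_def space_F using sets_F_mono[of s t] by blast

lemma measurable_G_imp_M: "f \<in> G s \<rightarrow>\<^sub>M N \<Longrightarrow> f \<in> M \<rightarrow>\<^sub>M N"
  using measurable_from_subalg[OF subalgebra_G] .

lemma measurable_M_imp_P: "f \<in> M \<rightarrow>\<^sub>M N \<Longrightarrow> f \<in> P x \<rightarrow>\<^sub>M N"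
  by (simp add: measurable_cong_sets[OF sets_P refl])

lemma measurable_W_P: "0 \<le> t \<Longrightarrow> W t \<in> borel_measurable (P x)"
  by (intro measurable_M_imp_P measurable_G_imp_M[OF adapted])

lemma measurable_W_completion: "0 \<le> t \<Longrightarrow> W t \<in> borel_measurable (completion (P x))"
  by (intro measurable_completion measurable_W_P)

section \<open>Events of the universal completion and stopping times\<close>

lemma universal_completion_subset: "{A. A \<subseteq> space M \<and>
         (\<forall>\<mu> \<in> space (prob_algebra (borel :: real measure)).
            \<exists>B \<in> sets H. sym_diff A B \<in> null_sets (completion (\<mu> \<bind> P)))} \<subseteq> Pow (space M)"
  by auto

lemma space_universal_completion [simp]: "space (universal_completion M P H) = space M"
  unfolding universal_completion_def by (rule space_measure_of[OF universal_completion_subset])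

lemma sets_G_subset_universal_completion: "sets (G t) \<subseteq> sets (universal_completion M P (G t))"
proof
  fix A assume "A \<in> sets (G t)"
  then have "A \<subseteq> space M" using sets.sets_into_space space_F by blast
  then show "A \<in> sets (universal_completion M P (G t))"
    unfolding universal_completion_def sets_measure_of[OF universal_completion_subset]
    using \<open>A \<in> sets (G t)\<close> by (intro sigma_sets.Basic) (auto intro!: bexI[of _ A])
qed

text \<open>The approximation property of the generating sets survives complements and countable
  unions, so it holds on the whole generated \<sigma>-algebra by induction. Only the laws
  \<open>P x\<close> matter later.\<close>

lemma universal_completion_null_sym_diff:
  assumes "A \<in> sets (universal_completion M P (G t))"
  obtains B where "B \<in> sets (G t)" "sym_diff A B \<in> null_sets (completion (P x))"
proof -
  have "A \<in> sigma_sets (space M) {A. A \<subseteq> space M \<and>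
         (\<forall>\<mu> \<in> space (prob_algebra (borel :: real measure)).
            \<exists>B \<in> sets (G t). sym_diff A B \<in> null_sets (completion (\<mu> \<bind> P)))}"
    using assms unfolding universal_completion_def sets_measure_of[OF universal_completion_subset] .
  then have "\<exists>B\<in>sets (G t). sym_diff A B \<in> null_sets (completion (P x))"
  proof induction
    case (Basic A)
    \<comment> \<open>The point mass at \<open>x\<close> is an admissible initial distribution, and
      mixing the kernel over it gives back \<open>P x\<close>.\<close>
    have "return borel x \<in> space (prob_algebra borel)"
      by (simp add: space_prob_algebra prob_space_return)
    moreover have "return borel x \<bind> P = P x"
      by (rule bind_return[OF measurable_prob_algebraD[OF kernel]]) simp
    ultimately show ?case using Basic by force
  next
    case Empty
    then show ?case by (intro bexI[of _ "{}"]) auto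
  next
    case (Compl A)
    then obtain B where B: "B \<in> sets (G t)" "sym_diff A B \<in> null_sets (completion (P x))" by auto
    have "sym_diff (space M - A) (space M - B) \<subseteq> sym_diff A B" by auto
    then have "sym_diff (space M - A) (space M - B) \<in> null_sets (completion (P x))"
      using null_sets_completion_subset B(2) by blast
    then show ?case using B(1) sets.compl_sets[of B "G t"] by (auto simp: space_F)
  next
    case (Union A)
    then obtain B where B: "\<And>i. B i \<in> sets (G t)" "\<And>i. sym_diff (A i) (B i) \<in> null_sets (completion (P x))"
      by metis
    have "(\<Union>i. sym_diff (A i) (B i)) \<in> null_sets (completion (P x))" using B(2) by auto
    moreover have "sym_diff (\<Union>i. A i) (\<Union>i. B i) \<subseteq> (\<Union>i. sym_diff (A i) (B i))" by blast
    ultimately have "sym_diff (\<Union>i. A i) (\<Union>i. B i) \<in> null_sets (completion (P x))"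
      using null_sets_completion_subset by blast
    then show ?case using B(1) by (intro bexI[of _ "\<Union>i. B i"]) auto
  qed
  then show thesis using that by blast
qed

lemma universal_completion_AE_eq:
  assumes "A \<in> sets (universal_completion M P (G t))"
  obtains B where "B \<in> sets (G t)" "AE \<omega> in completion (P x). \<omega> \<in> A \<longleftrightarrow> \<omega> \<in> B"
proof -
  obtain B where B: "B \<in> sets (G t)" "sym_diff A B \<in> null_sets (completion (P x))"
    using universal_completion_null_sym_diff[OF assms] .
  have "AE \<omega> in completion (P x). \<omega> \<in> A \<longleftrightarrow> \<omega> \<in> B"
    by (rule AE_I'[OF B(2)]) auto
  then show thesis using that B(1) by blast
qed

lemma universal_completion_in_completion:
  assumes "A \<in> sets (universal_completion M P (G t))"
  shows "A \<in> sets (completion (P x))"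
proof -
  obtain B where B: "B \<in> sets (G t)" "sym_diff A B \<in> null_sets (completion (P x))"
    using universal_completion_null_sym_diff[OF assms] .
  have "B \<in> sets (P x)" using B(1) subalgebra_G[of t] sets_P[of x] by (auto simp: subalgebra_def)
  then have "B \<in> sets (completion (P x))" by simp
  moreover have "A - B \<in> sets (completion (P x))" "B - A \<in> sets (completion (P x))"
    using null_sets_completion_subset[OF _ B(2)] by blast+
  moreover have "A = (B \<union> (A - B)) - (B - A)" by auto
  ultimately show ?thesis by (metis sets.Diff sets.Un)
qed

text \<open>Entering the closed set during \<open>{0..r}\<close> is an uncountable union over times.
  It is rewritten through a countable dense set \<open>Q\<close> of times: the path comes within
  \<open>1 / Suc n\<close> of the set, for every \<open>n\<close>, at some time in
  \<open>Q\<close>.\<close>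

lemma hitting_time_le_in_G:
  assumes A: "closed A" and r: "0 \<le> r"
  shows "{\<omega> \<in> space M. hitting_time W A \<omega> \<le> ennreal r} \<in> sets (G (ennreal r))"
proof -
  let ?C = "absorbing A"
  have C: "closed ?C" "?C \<noteq> {}" using closed_absorbing[OF A] by (auto simp: absorbing_def intro: exI[of _ 0])
  obtain Q where Q: "countable Q" "Q \<subseteq> {0..r}" "{0..r} \<subseteq> closure Q" using separable[of "{0..r}"] by blast
  have "{\<omega> \<in> space M. hitting_time W A \<omega> \<le> ennreal r} =
      {\<omega> \<in> space (G (ennreal r)). \<forall>n::nat. \<exists>q\<in>Q. infdist (W q \<omega>) ?C < 1 / Suc n}"
  proof (rule Collect_cong, unfold space_F, rule conj_cong[OF refl])
    fix \<omega> assume "\<omega> \<in> space M"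
    note cont = continuous_paths[OF this]
    have cont_r: "continuous_on {0..r} (\<lambda>t. W t \<omega>)" by (rule continuous_on_subset[OF cont]) auto
    show "hitting_time W A \<omega> \<le> ennreal r \<longleftrightarrow> (\<forall>n::nat. \<exists>q\<in>Q. infdist (W q \<omega>) ?C < 1 / Suc n)"
      unfolding hitting_time_le_iff[of W \<omega> A r, OF cont A r]
    proof safe
      fix s n assume s: "s \<in> {0..r}" "W s \<omega> \<in> ?C"
      then obtain d where d: "d > 0" "\<And>q. q \<in> {0..r} \<Longrightarrow> dist q s < d \<Longrightarrow> dist (W q \<omega>) (W s \<omega>) < 1 / Suc n"
        using cont_r unfolding continuous_on_iff by (metis of_nat_0_less_iff zero_less_Suc zero_less_divide_1_iff)
      obtain q where q: "q \<in> Q" "dist q s < d" using Q(3) s(1) d(1) closure_approachable by blast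
      then have "dist (W q \<omega>) (W s \<omega>) < 1 / Suc n" using d(2) Q(2) by blast
      then show "\<exists>q\<in>Q. infdist (W q \<omega>) ?C < 1 / Suc n"
        using q(1) infdist_le[OF s(2), of "W q \<omega>"] by (intro bexI[of _ q]) auto
    next
      assume *: "\<forall>n::nat. \<exists>q\<in>Q. infdist (W q \<omega>) ?C < 1 / Suc n"
      \<comment> \<open>The distance to the set attains its minimum on the compact time interval.
        That minimum is below every \<open>1 / Suc n\<close>, so it is zero, and the set is
        closed.\<close>
      have "continuous_on {0..r} (\<lambda>t. infdist (W t \<omega>) ?C)" by (intro continuous_intros cont_r)
      then obtain s where s: "s \<in> {0..r}" "\<And>q. q \<in> {0..r} \<Longrightarrow> infdist (W s \<omega>) ?C \<le> infdist (W q \<omega>) ?C"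
        using continuous_attains_inf[of "{0..r}"] r by fastforce
      have "infdist (W s \<omega>) ?C < 1 / Suc n" for n :: nat
        using * s(2) Q(2) by (meson order_le_less_trans subsetD)
      then have "\<not> 0 < infdist (W s \<omega>) ?C"
        using nat_approx_posE by (metis order_less_asym)
      then have "W s \<omega> \<in> ?C" using in_closed_iff_infdist_zero[OF C] infdist_nonneg by (metis less_eq_real_def)
      then show "\<exists>s\<in>{0..r}. W s \<omega> \<in> ?C" using s(1) by blast
    qed
  qed
  moreover have "{\<omega> \<in> space (G (ennreal r)). \<forall>n::nat. \<exists>q\<in>Q. infdist (W q \<omega>) ?C < 1 / Suc n} \<in> sets (G (ennreal r))"
  proof (intro sets.sets_Collect_countable_All sets.sets_Collect_countable_Ex'[OF _ Q(1)])
    fix n :: nat and q assume "q \<in> Q"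
    then have [measurable]: "W q \<in> borel_measurable (G (ennreal r))"
      using Q(2) by (intro measurable_G_mono[OF adapted]) (auto intro: ennreal_leI)
    have [measurable]: "(\<lambda>y. infdist y ?C) \<in> borel_measurable borel"
      by (intro borel_measurable_continuous_onI continuous_intros)
    show "{\<omega> \<in> space (G (ennreal r)). infdist (W q \<omega>) ?C < 1 / Suc n} \<in> sets (G (ennreal r))"
      by measurable
  qed
  ultimately show ?thesis by simp
qed

lemma stopping_timesD:
  assumes "\<tau> \<in> stopping_times M G P"
  shows "{\<omega> \<in> space M. \<tau> \<omega> \<le> t} \<in> sets (universal_completion M P (G t))"
  using assms unfolding stopping_times_def stopping_time_def by (auto simp: pred_def)

lemma hitting_time_stopping_time:
  assumes "closed A"
  shows "hitting_time W A \<in> stopping_times M G P"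
  unfolding stopping_times_def stopping_time_def
proof (intro CollectI allI)
  fix t :: ennreal
  show "Measurable.pred (universal_completion M P (G t)) (\<lambda>\<omega>. hitting_time W A \<omega> \<le> t)"
  proof (cases t rule: ennreal_cases)
    case (real r)
    then show ?thesis
      using hitting_time_le_in_G[OF assms real(1)] sets_G_subset_universal_completion
      unfolding pred_def by auto
  qed auto
qed

lemma stopping_times_min:
  assumes "\<sigma> \<in> stopping_times M G P" "\<tau> \<in> stopping_times M G P"
  shows "(\<lambda>\<omega>. min (\<sigma> \<omega>) (\<tau> \<omega>)) \<in> stopping_times M G P"
  using assms unfolding stopping_times_def stopping_time_def mem_Collect_eq min_le_iff_disj
  by (intro allI pred_intros_logic(5)) blast+

lemma stopping_time_measurable:
  assumes "\<tau> \<in> stopping_times M G P"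
  shows "\<tau> \<in> borel_measurable (completion (P x))"
proof (rule borel_measurableI_le)
  fix t show "{\<omega> \<in> space (completion (P x)). \<tau> \<omega> \<le> t} \<in> sets (completion (P x))"
    using universal_completion_in_completion[OF stopping_timesD[OF assms]] by (simp add: space_P)
qed

text \<open>Being inside the unit interval at time \<open>Suc n\<close> forces the increment from
  the start into an interval of length 1. The density of that increment is at most
  \<open>1 / sqrt (2 * pi * Suc n)\<close>, so the probability of never leaving is zero.\<close>

lemma exit_time_finite: "AE \<omega> in P x. exit_time W \<omega> < \<infinity>"
proof -
  interpret prob_space "P x" by (rule prob_space_P)
  let ?E = "\<lambda>n::nat. {\<omega> \<in> space (P x). W (Suc n) \<omega> - W 0 \<omega> \<in> {-x<..<1-x}}"
  have [measurable]: "W t \<in> borel_measurable (P x)" if "0 \<le> t" for t using measurable_W_P[OF that] .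
  have E: "?E n \<in> sets (P x)" for n using measurable_W_P[of "Suc n"] measurable_W_P[of 0] by measurable
  have bound: "emeasure (P x) (?E n) \<le> ennreal (1 / sqrt (2 * pi * Suc n))" for n
  proof -
    have D: "distributed (P x) lborel (\<lambda>\<omega>. W (Suc n) \<omega> - W 0 \<omega>) (normal_density 0 (sqrt (Suc n)))"
      using gaussian_increments[of 0 "Suc n" x] by simp
    have "?E n = (\<lambda>\<omega>. W (Suc n) \<omega> - W 0 \<omega>) -` {-x<..<1-x} \<inter> space (P x)" by auto
    then have "emeasure (P x) (?E n) = (\<integral>\<^sup>+y. ennreal (normal_density 0 (sqrt (Suc n)) y) * indicator {-x<..<1-x} y \<partial>lborel)"
      using distributed_emeasure[OF D, of "{-x<..<1-x}"] by simp
    also have "\<dots> \<le> (\<integral>\<^sup>+y. ennreal (1 / sqrt (2 * pi * Suc n)) * indicator {-x<..<1-x} y \<partial>lborel)"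
    proof (intro nn_integral_mono mult_right_mono ennreal_leI)
      fix y :: real
      have "exp (- y\<^sup>2 / (2 * real (Suc n))) \<le> 1" by simp
      then show "normal_density 0 (sqrt (Suc n)) y \<le> 1 / sqrt (2 * pi * Suc n)"
        unfolding normal_density_def by (simp add: divide_right_mono)
    qed auto
    also have "\<dots> = ennreal (1 / sqrt (2 * pi * Suc n))"
      by (subst nn_integral_cmult_indicator) auto
    finally show ?thesis .
  qed
  have "(\<lambda>n. ennreal (1 / sqrt (2 * pi * Suc n))) \<longlonglongrightarrow> ennreal 0"
    by (intro tendsto_ennrealI, real_asymp)
  then have "emeasure (P x) (\<Inter>n. ?E n) \<le> ennreal 0"
  proof (rule LIMSEQ_le_const)
    have "emeasure (P x) (\<Inter>n. ?E n) \<le> ennreal (1 / sqrt (2 * pi * Suc n))" for n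
      by (rule order_trans[OF emeasure_mono bound[of n]]) (use E in auto)
    then show "\<exists>N. \<forall>n\<ge>N. emeasure (P x) (\<Inter>n. ?E n) \<le> ennreal (1 / sqrt (2 * pi * Suc n))" by blast
  qed
  then have "(\<Inter>n. ?E n) \<in> null_sets (P x)" using E by (intro null_setsI) auto
  then have "AE \<omega> in P x. \<omega> \<notin> (\<Inter>n. ?E n)" by (rule AE_not_in)
  then show ?thesis using start[of x] AE_space
  proof eventually_elim
    case (elim \<omega>)
    then obtain n where n: "\<omega> \<notin> ?E n" by blast
    then have "W (Suc n) \<omega> \<notin> {0<..<1}" using elim by auto
    then have "exit_time W \<omega> \<le> ennreal (Suc n)" unfolding exit_time_def by (intro Inf_lower imageI) simp
    then show ?case by (simp add: order_le_less_trans)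
  qed
qed

end

section \<open>Optional stopping for Brownian motion\<close>

lemma (in prob_space) expectation_cis_normal:
  assumes D: "distributed M lborel X (normal_density 0 \<sigma>)" and \<sigma>: "0 < \<sigma>"
  shows "(\<integral>\<omega>. cis (\<theta> * X \<omega>) \<partial>M) = exp (- (\<theta>\<^sup>2 * \<sigma>\<^sup>2) / 2)"
proof -
  let ?Y = "\<lambda>\<omega>. (X \<omega> - 0) / \<sigma>"
  have Y: "distributed M lborel ?Y std_normal_density"
    using D unfolding normal_standard_normal_convert[OF \<sigma>] by simp
  have X[measurable]: "X \<in> borel_measurable M" using distributed_measurable[OF D] by simp
  have eq: "distr M lborel ?Y = std_normal_distribution"
    using distributed_distr_eq_density[OF Y] by simp
  have "(\<integral>\<omega>. cis (\<theta> * X \<omega>) \<partial>M) = (\<integral>\<omega>. cis ((\<theta> * \<sigma>) * ?Y \<omega>) \<partial>M)"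
    using \<sigma> by (intro Bochner_Integration.integral_cong refl arg_cong[of _ _ cis]) simp
  also have "\<dots> = (\<integral>y. cis ((\<theta> * \<sigma>) * y) \<partial>distr M lborel ?Y)"
    by (subst integral_distr) (auto intro!: borel_measurable_continuous_onI continuous_intros)
  also have "\<dots> = char std_normal_distribution (\<theta> * \<sigma>)"
    unfolding eq char_def by (simp add: cis_conv_exp)
  also have "\<dots> = exp (- (\<theta>\<^sup>2 * \<sigma>\<^sup>2) / 2)"
    unfolding char_std_normal_distribution by (simp add: power_mult_distrib exp_of_real[symmetric])
  finally show ?thesis .
qed

lemma cis_mult_measurable [measurable]:
  "X \<in> borel_measurable N \<Longrightarrow> (\<lambda>\<omega>. cis (\<theta> * X \<omega>)) \<in> borel_measurable N"
  by (rule borel_measurable_continuous_on[where f="\<lambda>y. cis (\<theta> * y)"]) (auto intro!: continuous_intros)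

section \<open>The complex exponential martingale\<close>

context brownian_motion_family
begin

text \<open>The Wald martingale with an imaginary parameter. Its modulus is deterministic, so
  integrability and domination on bounded time intervals are immediate, and its martingale property
  needs only the characteristic function of the increments.\<close>

definition exp_mart :: "real \<Rightarrow> real \<Rightarrow> 'a \<Rightarrow> complex" where
  "exp_mart \<theta> t \<omega> = cis (\<theta> * W t \<omega>) * of_real (exp (\<theta>\<^sup>2 * t / 2))"

lemma norm_exp_mart: "norm (exp_mart \<theta> t \<omega>) = exp (\<theta>\<^sup>2 * t / 2)"
  by (simp add: exp_mart_def norm_mult)

lemma exp_mart_measurable:
  "W t \<in> borel_measurable N \<Longrightarrow> exp_mart \<theta> t \<in> borel_measurable N"
  unfolding exp_mart_def[abs_def]
  by (intro borel_measurable_times cis_mult_measurable borel_measurable_const)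

lemma integrable_bounded_completion:
  fixes f :: "'a \<Rightarrow> 'b::{banach, second_countable_topology}"
  assumes "f \<in> borel_measurable (completion (P x))" "AE \<omega> in completion (P x). norm (f \<omega>) \<le> B"
  shows "integrable (completion (P x)) f"
proof -
  interpret prob_space "completion (P x)" by (rule prob_space.prob_space_completion[OF prob_space_P])
  show ?thesis by (rule integrable_const_bound[OF assms(2,1)])
qed

text \<open>This is the martingale property, tested against events of the completed filtration. Such
  an event may be replaced by a null-equivalent \<open>B\<close> from \<open>G\<close>, for which
  the independence of increments is available.\<close>

lemma exp_mart_increment:
  assumes st: "0 \<le> s" "s < t" and A: "A \<in> sets (universal_completion M P (G (ennreal s)))"
  shows "(\<integral>\<omega>. indicator A \<omega> * (exp_mart \<theta> t \<omega> - exp_mart \<theta> s \<omega>) \<partial>completion (P x)) = 0"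
proof -
  interpret prob_space "P x" by (rule prob_space_P)
  obtain B where B: "B \<in> sets (G (ennreal s))" "AE \<omega> in completion (P x). \<omega> \<in> A \<longleftrightarrow> \<omega> \<in> B"
    using universal_completion_AE_eq[OF A] .
  have BM[measurable]: "B \<in> sets (P x)" using B(1) subalgebra_G sets_P by (auto simp: subalgebra_def)
  have Ws[measurable]: "W s \<in> borel_measurable (P x)" and Wt[measurable]: "W t \<in> borel_measurable (P x)"
    using st by (auto intro: measurable_W_P)
  note [measurable] = exp_mart_measurable[OF Ws] exp_mart_measurable[OF Wt] universal_completion_in_completion[OF A]
  \<comment> \<open>On \<open>B\<close> the value at time \<open>t\<close> is the product of the
    past \<open>X1\<close>, the increment factor \<open>X2\<close> and the deterministic growth
    \<open>r t\<close>.\<close>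
  define X1 where "X1 = (\<lambda>\<omega>. indicator B \<omega> * cis (\<theta> * W s \<omega>) :: complex)"
  define X2 where "X2 = (\<lambda>\<omega>. cis (\<theta> * (W t \<omega> - W s \<omega>)))"
  define r where "r u = exp (\<theta>\<^sup>2 * u / 2)" for u
  have [measurable]: "X1 \<in> borel_measurable (P x)" "X2 \<in> borel_measurable (P x)"
    unfolding X1_def X2_def by measurable
  have indep: "indep_var borel X1 borel X2"
    unfolding indep_var_eq
  proof (intro conjI)
    let ?S1 = "sigma_sets (space (P x)) {X1 -` A \<inter> space (P x) |A. A \<in> sets borel}"
    let ?S2 = "sigma_sets (space (P x)) {X2 -` A \<inter> space (P x) |A. A \<in> sets borel}"
    let ?V = "vimage_algebra (space M) (\<lambda>\<omega>. W t \<omega> - W s \<omega>) borel"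
    have "W s \<in> borel_measurable (G (ennreal s))" using st(1) by (rule adapted)
    then have X1G: "X1 \<in> borel_measurable (G (ennreal s))" unfolding X1_def using B(1) by measurable
    have S1: "?S1 \<subseteq> sets (G (ennreal s))"
      unfolding space_P using measurable_sets[OF X1G]
      by (subst space_F[of "ennreal s", symmetric], intro sets.sigma_sets_subset) (auto simp: space_F)
    have "(\<lambda>\<omega>. W t \<omega> - W s \<omega>) \<in> borel_measurable ?V" by (rule measurable_vimage_algebra1) simp
    then have X2V: "X2 \<in> borel_measurable ?V" unfolding X2_def by measurable
    have S2: "?S2 \<subseteq> sets ?V"
    proof -
      have "?S2 = sigma_sets (space ?V) {X2 -` A \<inter> space ?V |A. A \<in> sets borel}" by (simp add: space_P)
      also have "\<dots> \<subseteq> sets ?V" using measurable_sets[OF X2V] by (intro sets.sigma_sets_subset) auto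
      finally show ?thesis .
    qed
    have ind: "indep_set (sets (G (ennreal s))) (sets ?V)" using independent_increments[OF st] .
    show "indep_set ?S1 ?S2"
    proof (rule indep_setI)
      show "?S1 \<subseteq> events" "?S2 \<subseteq> events" by (auto intro!: sets.sigma_sets_subset measurable_sets[of _ _ borel])
    next
      fix a b assume "a \<in> ?S1" "b \<in> ?S2"
      then show "prob (a \<inter> b) = prob a * prob b" using indep_setD[OF ind] S1 S2 by blast
    qed
  qed measurable
  have b1: "integrable (P x) X1" "integrable (P x) X2"
    by (rule integrable_const_bound[of _ 1]; auto simp: X1_def X2_def norm_mult split: split_indicator)+
  have i12: "(\<integral>\<omega>. X1 \<omega> * X2 \<omega> \<partial>P x) = (\<integral>\<omega>. X1 \<omega> \<partial>P x) * exp (- (\<theta>\<^sup>2 * (t - s)) / 2)"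
    using expectation_cis_normal[OF gaussian_increments[OF st], of \<theta>] st
    unfolding indep_var_lebesgue_integral[OF indep b1] unfolding X2_def by simp
  have "(\<integral>\<omega>. indicator A \<omega> * (exp_mart \<theta> t \<omega> - exp_mart \<theta> s \<omega>) \<partial>completion (P x)) =
      (\<integral>\<omega>. indicator B \<omega> * (exp_mart \<theta> t \<omega> - exp_mart \<theta> s \<omega>) \<partial>completion (P x))"
  proof (rule integral_cong_AE)
    have d: "(\<lambda>\<omega>. exp_mart \<theta> t \<omega> - exp_mart \<theta> s \<omega>) \<in> borel_measurable (completion (P x))"
      by (intro measurable_completion borel_measurable_diff exp_mart_measurable Ws Wt)
    have i: "indicator D \<in> borel_measurable (completion (P x))" if "D \<in> sets (completion (P x))" for D :: "'a set"
      using that by (rule borel_measurable_indicator)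
    show "(\<lambda>\<omega>. indicator A \<omega> * (exp_mart \<theta> t \<omega> - exp_mart \<theta> s \<omega>)) \<in> borel_measurable (completion (P x))"
      "(\<lambda>\<omega>. indicator B \<omega> * (exp_mart \<theta> t \<omega> - exp_mart \<theta> s \<omega>)) \<in> borel_measurable (completion (P x))"
      using universal_completion_in_completion[OF A] BM by (auto intro!: borel_measurable_times d i)
  qed (use B(2) in \<open>auto simp: indicator_def elim: eventually_mono\<close>)
  also have "\<dots> = (\<integral>\<omega>. indicator B \<omega> * (exp_mart \<theta> t \<omega> - exp_mart \<theta> s \<omega>) \<partial>P x)"
    by (rule integral_completion) measurable
  also have "\<dots> = (\<integral>\<omega>. X1 \<omega> * X2 \<omega> * of_real (r t) - X1 \<omega> * of_real (r s) \<partial>P x)"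
    by (intro Bochner_Integration.integral_cong refl)
      (simp add: X1_def X2_def r_def exp_mart_def algebra_simps flip: cis_mult cis_divide)
  also have "\<dots> = (\<integral>\<omega>. X1 \<omega> * X2 \<omega> \<partial>P x) * of_real (r t) - (\<integral>\<omega>. X1 \<omega> \<partial>P x) * of_real (r s)"
    using b1 indep_var_integrable[OF indep b1] by simp
  also have "\<dots> = (\<integral>\<omega>. X1 \<omega> \<partial>P x) * of_real (exp (- (\<theta>\<^sup>2 * (t - s)) / 2) * r t - r s)"
    unfolding i12 by (simp add: algebra_simps)
  \<comment> \<open>The growth factor in \<open>exp_mart\<close> is chosen to cancel exactly the
    decay of the characteristic function over \<open>t - s\<close>.\<close>
  also have "exp (- (\<theta>\<^sup>2 * (t - s)) / 2) * r t = r s"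
    unfolding r_def mult_exp_exp by (simp add: field_simps)
  finally show ?thesis by simp
qed

lemma exp_mart_start:
  assumes "0 \<le> T"
  shows "(\<integral>\<omega>. exp_mart \<theta> T \<omega> \<partial>completion (P x)) = cis (\<theta> * x)"
proof -
  interpret prob_space "completion (P x)" by (rule prob_space.prob_space_completion[OF prob_space_P])
  have W0: "AE \<omega> in completion (P x). W 0 \<omega> = x" using start AE_completion by blast
  have [measurable]: "exp_mart \<theta> t \<in> borel_measurable (completion (P x))" if "0 \<le> t" for t
    using exp_mart_measurable[OF measurable_W_completion[OF that]] .
  have int: "integrable (completion (P x)) (exp_mart \<theta> t)" if "0 \<le> t" for t
    by (rule integrable_bounded_completion) (use that in \<open>auto simp: norm_exp_mart\<close>)
  have "(\<integral>\<omega>. exp_mart \<theta> T \<omega> \<partial>completion (P x)) = (\<integral>\<omega>. exp_mart \<theta> 0 \<omega> \<partial>completion (P x))"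
  proof (cases "T = 0")
    case False
    then have "(\<integral>\<omega>. indicator (space M) \<omega> * (exp_mart \<theta> T \<omega> - exp_mart \<theta> 0 \<omega>) \<partial>completion (P x)) = 0"
      using assms sets.top[of "universal_completion M P (G (ennreal 0))"] by (intro exp_mart_increment) auto
    also have "(\<integral>\<omega>. indicator (space M) \<omega> * (exp_mart \<theta> T \<omega> - exp_mart \<theta> 0 \<omega>) \<partial>completion (P x)) =
        (\<integral>\<omega>. exp_mart \<theta> T \<omega> - exp_mart \<theta> 0 \<omega> \<partial>completion (P x))"
      by (intro Bochner_Integration.integral_cong refl) (simp add: space_P)
    finally show ?thesis using int[OF assms] int[of 0] by simp
  qed simp
  also have "\<dots> = (\<integral>\<omega>. cis (\<theta> * x) \<partial>completion (P x))"
    by (rule integral_cong_AE) (use W0 measurable_W_completion[of 0 x] in \<open>auto simp: exp_mart_def\<close>)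
  finally show ?thesis using prob_space.prob_space[OF prob_space_P] by simp
qed

end

text \<open>The partial sums below telescope from the first grid point that is not smaller than \<open>u\<close>.\<close>

lemma grid_telescope:
  fixes a :: "real \<Rightarrow> 'b::real_normed_vector" and u T :: real and m :: nat
  assumes "0 \<le> u" "u \<le> T" "0 < T" "0 < m"
  defines "j \<equiv> nat \<lceil>m * u / T\<rceil>"
  shows "a T - (\<Sum>k<m. if u \<le> k * T / m then a (Suc k * T / m) - a (k * T / m) else 0) = a (j * T / m)"
    and "u \<le> j * T / m" "j * T / m \<le> u + T / m"
proof -
  have le: "u \<le> k * T / m \<longleftrightarrow> j \<le> k" for k :: nat
    unfolding j_def nat_ceiling_le_eq using assms(3,4) by (simp add: field_simps)
  have jm: "j \<le> m" unfolding j_def nat_ceiling_le_eq using assms(1-4) by (simp add: field_simps)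
  have "(\<Sum>k<m. if u \<le> k * T / m then a (Suc k * T / m) - a (k * T / m) else 0) =
      (\<Sum>k\<in>{j..<m}. a (Suc k * T / m) - a (k * T / m))"
    unfolding le by (rule sum.mono_neutral_cong_right) auto
  also have "\<dots> = a (m * T / m) - a (j * T / m)"
    using sum_Suc_diff'[OF jm, of "\<lambda>k. a (k * T / m)"] by simp
  finally show "a T - (\<Sum>k<m. if u \<le> k * T / m then a (Suc k * T / m) - a (k * T / m) else 0) = a (j * T / m)"
    using assms(4) by simp
  show "u \<le> j * T / m" unfolding le ..
  have "0 \<le> m * u / T" using assms by simp
  then have "real j \<le> m * u / T + 1" unfolding j_def by linarith
  then show "j * T / m \<le> u + T / m" using assms(3,4) by (simp add: field_simps)
qed

section \<open>Stopping the exponential martingale at a bounded time\<close>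

context brownian_motion_family
begin

lemma exp_mart_continuous:
  assumes "\<omega> \<in> space M"
  shows "continuous_on {0..} (\<lambda>t. exp_mart \<theta> t \<omega>)"
  unfolding exp_mart_def by (intro continuous_intros continuous_paths[OF assms]) simp

text \<open>The stopped value is approximated by its value at the first grid point not before
  \<open>S\<close>. That value is the one at \<open>T\<close> minus the later grid increments, each
  of which is switched on by an event known at its left end and so has mean zero. Refining the grid
  and dominated convergence give the claim.\<close>

lemma exp_mart_stopped:
  assumes \<tau>: "\<tau> \<in> stopping_times M G P" and T: "0 < T"
  defines "S \<equiv> \<lambda>\<omega>. enn2real (min (\<tau> \<omega>) (ennreal T))"
  shows "(\<lambda>\<omega>. exp_mart \<theta> (S \<omega>) \<omega>) \<in> borel_measurable (completion (P x))"
    and "(\<integral>\<omega>. exp_mart \<theta> (S \<omega>) \<omega> \<partial>completion (P x)) = cis (\<theta> * x)"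
proof -
  interpret prob_space "completion (P x)" by (rule prob_space.prob_space_completion[OF prob_space_P])
  let ?N = "completion (P x)"
  define A where "A u = {\<omega> \<in> space M. \<tau> \<omega> \<le> ennreal u}" for u
  have A_uc: "A u \<in> sets (universal_completion M P (G (ennreal u)))" for u
    unfolding A_def by (rule stopping_timesD[OF \<tau>])
  have A_N[measurable]: "A u \<in> sets ?N" for u
    by (rule universal_completion_in_completion[OF A_uc])
  have meas: "exp_mart \<theta> t \<in> borel_measurable ?N" if "0 \<le> t" for t
    using exp_mart_measurable[OF measurable_W_completion[OF that]] .
  define t where "t n k = real k * T / real (Suc n)" for n k :: nat
  have t0: "0 \<le> t n k" for n k using T by (simp add: t_def)
  have t_less: "t n k < t n (Suc k)" for n k
    unfolding t_def using T by (intro divide_strict_right_mono mult_strict_right_mono) auto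
  define Y where "Y n k \<omega> = indicator (A (t n k)) \<omega> * (exp_mart \<theta> (t n (Suc k)) \<omega> - exp_mart \<theta> (t n k) \<omega>)" for n k \<omega>
  define Z where "Z n \<omega> = exp_mart \<theta> T \<omega> - (\<Sum>k<Suc n. Y n k \<omega>)" for n \<omega>
  have Y_meas: "Y n k \<in> borel_measurable ?N" for n k
    unfolding Y_def[abs_def] by (intro borel_measurable_times borel_measurable_indicator borel_measurable_diff meas t0 A_N)
  have Z_meas: "Z n \<in> borel_measurable ?N" for n
    unfolding Z_def[abs_def] using T by (intro borel_measurable_diff borel_measurable_sum Y_meas meas) simp
  have S: "0 \<le> S \<omega>" "S \<omega> \<le> T" for \<omega>
    using T enn2real_mono[of "min (\<tau> \<omega>) (ennreal T)" "ennreal T"] by (simp_all add: S_def)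
  have A_iff: "\<omega> \<in> A (t n k) \<longleftrightarrow> S \<omega> \<le> t n k" if "\<omega> \<in> space M" "k < Suc n" for \<omega> n k
  \<comment> \<open>Only grid points strictly below \<open>T\<close> occur here, so truncating
    \<tau> at \<open>T\<close> does not change the comparison.\<close>
  proof -
    have "real k * T < T * real (Suc n)"
      unfolding mult.commute[of T] using that(2) T by (intro mult_strict_right_mono) auto
    then have "t n k < T" unfolding t_def by (subst pos_divide_less_eq) auto
    then have "S \<omega> \<le> t n k \<longleftrightarrow> min (\<tau> \<omega>) (ennreal T) \<le> ennreal (t n k)"
      unfolding S_def using t0[of n k] 
      by (metis ennreal_enn2real ennreal_le_iff ennreal_less_top min.strict_coboundedI2)
    also have "\<dots> \<longleftrightarrow> \<tau> \<omega> \<le> ennreal (t n k)"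
      using \<open>t n k < T\<close> t0[of n k] T by (simp add: min_le_iff_disj)
    finally show ?thesis using that(1) by (simp add: A_def)
  qed
  define v where "v n \<omega> = t n (nat \<lceil>Suc n * S \<omega> / T\<rceil>)" for n \<omega>
  have Z_eq: "Z n \<omega> = exp_mart \<theta> (v n \<omega>) \<omega>" if \<omega>: "\<omega> \<in> space M" for n \<omega>
  proof -
    have "(\<Sum>k<Suc n. Y n k \<omega>) = (\<Sum>k<Suc n. if S \<omega> \<le> k * T / Suc n
        then exp_mart \<theta> (Suc k * T / Suc n) \<omega> - exp_mart \<theta> (k * T / Suc n) \<omega> else 0)"
      by (intro sum.cong refl) (use A_iff[OF \<omega>] in \<open>auto simp: Y_def t_def indicator_def\<close>)
    then show ?thesis unfolding Z_def v_def t_def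
      using grid_telescope(1)[OF S T, of "Suc n" "\<lambda>t. exp_mart \<theta> t \<omega>"] by simp
  qed
  have v_bounds: "S \<omega> \<le> v n \<omega>" "v n \<omega> \<le> S \<omega> + T / Suc n" for n \<omega>
    using grid_telescope(2,3)[OF S T, of "Suc n" \<omega>] unfolding v_def t_def by auto
  have v_lim: "(\<lambda>n. v n \<omega>) \<longlonglongrightarrow> S \<omega>" for \<omega>
  proof (rule tendsto_sandwich[OF always_eventually always_eventually])
    show "\<forall>n. S \<omega> \<le> v n \<omega>" "\<forall>n. v n \<omega> \<le> S \<omega> + T / Suc n" using v_bounds by blast+
    have "(\<lambda>n. T * inverse (real (Suc n))) \<longlonglongrightarrow> T * 0"
      by (intro tendsto_mult tendsto_const LIMSEQ_inverse_real_of_nat)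
    then show "(\<lambda>n. S \<omega> + T / Suc n) \<longlonglongrightarrow> S \<omega>"
      using tendsto_add[OF tendsto_const[of "S \<omega>"]] by (fastforce simp: divide_inverse)
  qed simp
  have Z_lim: "(\<lambda>n. Z n \<omega>) \<longlonglongrightarrow> exp_mart \<theta> (S \<omega>) \<omega>" if \<omega>: "\<omega> \<in> space M" for \<omega>
  proof -
    have "(\<lambda>n. exp_mart \<theta> (v n \<omega>) \<omega>) \<longlonglongrightarrow> exp_mart \<theta> (S \<omega>) \<omega>"
      by (rule continuous_on_tendsto_compose[OF exp_mart_continuous[OF \<omega>] v_lim])
        (use S(1)[of \<omega>] order_trans[OF S(1) v_bounds(1)] in \<open>simp_all add: always_eventually\<close>)
    then show ?thesis using Z_eq[OF \<omega>] by simp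
  qed
  show lim_meas: "(\<lambda>\<omega>. exp_mart \<theta> (S \<omega>) \<omega>) \<in> borel_measurable ?N"
    by (rule borel_measurable_LIMSEQ_metric[OF Z_meas]) (use Z_lim in \<open>simp add: space_P\<close>)
  \<comment> \<open>The grid time exceeds \<open>S\<close> by at most \<open>T / Suc n\<close>,
    hence stays below \<open>2 * T\<close>; this gives a bound independent of
    \<open>n\<close>.\<close>
  have Z_bound: "norm (Z n \<omega>) \<le> exp (\<theta>\<^sup>2 * (2 * T) / 2)" if \<omega>: "\<omega> \<in> space M" for n \<omega>
  proof -
    have "T / Suc n \<le> T" using T by (simp add: field_simps)
    then have "v n \<omega> \<le> 2 * T" using v_bounds(2)[of n \<omega>] S(2)[of \<omega>] by linarith
    then show ?thesis unfolding Z_eq[OF \<omega>] norm_exp_mart exp_le_cancel_iff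
      by (intro divide_right_mono mult_left_mono) auto
  qed
  have int_mart: "integrable ?N (exp_mart \<theta> t)" if "0 \<le> t" for t
    by (rule integrable_bounded_completion[OF meas[OF that]]) (auto simp: norm_exp_mart)
  have int_Y: "integrable ?N (Y n k)" for n k
  proof (rule integrable_bounded_completion[OF Y_meas], intro AE_I2)
    fix \<omega>
    have "norm (Y n k \<omega>) \<le> norm (exp_mart \<theta> (t n (Suc k)) \<omega> - exp_mart \<theta> (t n k) \<omega>)"
      by (simp add: Y_def indicator_def)
    also have "\<dots> \<le> exp (\<theta>\<^sup>2 * t n (Suc k) / 2) + exp (\<theta>\<^sup>2 * t n k / 2)"
      using norm_triangle_ineq4 unfolding norm_exp_mart[symmetric, of _ _ \<omega>] .
    finally show "norm (Y n k \<omega>) \<le> exp (\<theta>\<^sup>2 * t n (Suc k) / 2) + exp (\<theta>\<^sup>2 * t n k / 2)" .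
  qed
  have "(\<integral>\<omega>. Z n \<omega> \<partial>?N) = cis (\<theta> * x)" for n
  proof -
    have "(\<integral>\<omega>. Y n k \<omega> \<partial>?N) = 0" for k
      unfolding Y_def by (rule exp_mart_increment[OF t0 t_less A_uc])
    then show ?thesis unfolding Z_def
      using int_mart[of T] int_Y exp_mart_start[of T] T by simp
  qed
  moreover have "(\<lambda>n. \<integral>\<omega>. Z n \<omega> \<partial>?N) \<longlonglongrightarrow> (\<integral>\<omega>. exp_mart \<theta> (S \<omega>) \<omega> \<partial>?N)"
    by (rule integral_dominated_convergence[OF lim_meas Z_meas, of "\<lambda>_. exp (\<theta>\<^sup>2 * (2 * T) / 2)"])
      (use Z_lim Z_bound in \<open>auto intro!: AE_I2 simp: space_P\<close>)
  ultimately show "(\<integral>\<omega>. exp_mart \<theta> (S \<omega>) \<omega> \<partial>?N) = cis (\<theta> * x)"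
    by (simp add: LIMSEQ_const_iff)
qed

end

lemma tendsto_scaled_sin: "(\<lambda>n. real (Suc n) * sin (y / real (Suc n))) \<longlonglongrightarrow> y"
proof -
  have "((\<lambda>h. sin (y * h)) has_real_derivative y) (at 0)" by (auto intro!: derivative_eq_intros)
  from DERIV_D[OF this] have "((\<lambda>h. sin (y * h) / h) \<longlongrightarrow> y) (at 0)" by simp
  moreover have "filterlim (\<lambda>n. inverse (real (Suc n))) (at 0) sequentially"
    using LIMSEQ_inverse_real_of_nat by (intro filterlim_atI) auto
  ultimately have "(\<lambda>n. sin (y * inverse (real (Suc n))) / inverse (real (Suc n))) \<longlonglongrightarrow> y"
    by (rule filterlim_compose)
  then show ?thesis by (simp add: divide_inverse mult.commute)
qed

section \<open>From the exponential to Brownian motion itself\<close>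

context brownian_motion_family
begin

text \<open>The stopped exponential martingale is bounded; its imaginary part, divided by \<open>\<theta> = 1 / (n + 1)\<close>,
  tends to \<open>W\<^sub>S - x\<close>. This avoids a maximal inequality for \<open>W\<close>.\<close>

lemma stopped_at_bounded_time:
  assumes \<tau>: "\<tau> \<in> stopping_times M G P" and T: "0 < T"
    and x: "x \<in> {0..1}" and exit: "\<forall>\<omega>\<in>space M. \<tau> \<omega> \<le> exit_time W \<omega>"
  defines "S \<equiv> \<lambda>\<omega>. enn2real (min (\<tau> \<omega>) (ennreal T))"
  shows "(\<lambda>\<omega>. W (S \<omega>) \<omega>) \<in> borel_measurable (completion (P x))"
    and "(\<integral>\<omega>. W (S \<omega>) \<omega> \<partial>completion (P x)) = x"
    and "AE \<omega> in completion (P x). W (S \<omega>) \<omega> \<in> {0..1}"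
proof -
  interpret prob_space "completion (P x)" by (rule prob_space.prob_space_completion[OF prob_space_P])
  let ?N = "completion (P x)"
  define a where "a n = 1 / real (Suc n)" for n :: nat
  have a: "0 < a n" "a n \<le> 1" for n by (simp_all add: a_def)
  \<comment> \<open>The factor \<open>cis (- (a n * x))\<close> centres at the starting point: the
    product then has mean 1, so its imaginary part has mean 0, and small angles turn it into the
    displacement.\<close>
  define Z where "Z n \<omega> = real (Suc n) * Im (cis (- (a n * x)) * exp_mart (a n) (S \<omega>) \<omega>)" for n \<omega>
  have S_eq: "S \<omega> = enn2real (min (\<tau> \<omega>) (ennreal T))" for \<omega> by (simp add: S_def)
  note mart = exp_mart_stopped[OF \<tau> T, folded S_eq]
  have Z_meas: "Z n \<in> borel_measurable ?N" for n
    unfolding Z_def[abs_def] by (intro borel_measurable_times borel_measurable_const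
        measurable_compose[OF _ borel_measurable_Im] mart(1))
  have S: "0 \<le> S \<omega>" "S \<omega> \<le> T" for \<omega>
    using T enn2real_mono[of "min (\<tau> \<omega>) (ennreal T)" "ennreal T"] by (simp_all add: S_def)
  have S_exit: "ennreal (S \<omega>) \<le> exit_time W \<omega>" if "\<omega> \<in> space M" for \<omega>
  proof -
    have "ennreal (S \<omega>) = min (\<tau> \<omega>) (ennreal T)"
      unfolding S_def by (intro ennreal_enn2real) (simp add: min_less_iff_disj)
    then show ?thesis using exit that by (auto intro: min.coboundedI1)
  qed
  have W0: "AE \<omega> in ?N. W 0 \<omega> = x" using start AE_completion by blast
  show range: "AE \<omega> in ?N. W (S \<omega>) \<omega> \<in> {0..1}"
    using W0 AE_space
  proof eventually_elim
    case (elim \<omega>)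
    then have "\<omega> \<in> space M" by (simp add: space_P)
    then show ?case
      using path_until_exit(3)[of W \<omega> "S \<omega>", OF continuous_paths] S(1) S_exit x elim(1) by blast
  qed
  have Z_eq: "Z n \<omega> = (real (Suc n) * sin ((W (S \<omega>) \<omega> - x) / real (Suc n))) * exp ((a n)\<^sup>2 * S \<omega> / 2)" for n \<omega>
  proof -
    have "- (a n * x) + a n * W (S \<omega>) \<omega> = (W (S \<omega>) \<omega> - x) / real (Suc n)"
      by (simp add: a_def diff_divide_distrib)
    then have "cis (- (a n * x)) * exp_mart (a n) (S \<omega>) \<omega> = cis ((W (S \<omega>) \<omega> - x) / real (Suc n)) * of_real (exp ((a n)\<^sup>2 * S \<omega> / 2))"
      unfolding exp_mart_def mult.assoc[symmetric] cis_mult by simp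
    then show ?thesis unfolding Z_def by simp
  qed
  have Z_lim: "(\<lambda>n. Z n \<omega>) \<longlonglongrightarrow> W (S \<omega>) \<omega> - x" for \<omega>
  proof -
    have "a \<longlonglongrightarrow> 0" using LIMSEQ_inverse_real_of_nat by (simp add: a_def[abs_def] inverse_eq_divide)
    then have "(\<lambda>n. exp ((a n)\<^sup>2 * S \<omega> / 2)) \<longlonglongrightarrow> exp (0\<^sup>2 * S \<omega> / 2)"
      by (intro tendsto_intros) auto
    from tendsto_mult[OF tendsto_scaled_sin this] show ?thesis by (simp add: Z_eq)
  qed
  have meas: "(\<lambda>\<omega>. W (S \<omega>) \<omega> - x) \<in> borel_measurable ?N"
    by (rule borel_measurable_LIMSEQ_metric[OF Z_meas]) (use Z_lim in simp)
  then have "(\<lambda>\<omega>. (W (S \<omega>) \<omega> - x) + x) \<in> borel_measurable ?N" by (intro borel_measurable_add) auto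
  then show meas': "(\<lambda>\<omega>. W (S \<omega>) \<omega>) \<in> borel_measurable ?N" by simp
  have bound: "AE \<omega> in ?N. norm (Z n \<omega>) \<le> exp (T / 2)" for n
    using range
  proof eventually_elim
    case (elim \<omega>)
    \<comment> \<open>Both points lie in the unit interval because the path is stopped by the exit
      time. With the sine bounded by its argument, the scaling by \<open>Suc n\<close> cancels and
      the bound is uniform in \<open>n\<close>.\<close>
    have "\<bar>W (S \<omega>) \<omega> - x\<bar> \<le> 1" using elim x by auto
    moreover have "real (Suc n) * \<bar>sin ((W (S \<omega>) \<omega> - x) / real (Suc n))\<bar> \<le> real (Suc n) * (\<bar>W (S \<omega>) \<omega> - x\<bar> / real (Suc n))"
      using abs_sin_x_le_abs_x[of "(W (S \<omega>) \<omega> - x) / real (Suc n)"]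
      by (intro mult_left_mono) (simp_all add: abs_divide)
    ultimately have "\<bar>real (Suc n) * sin ((W (S \<omega>) \<omega> - x) / real (Suc n))\<bar> \<le> 1"
      unfolding abs_mult by simp
    moreover have "(a n)\<^sup>2 * S \<omega> \<le> 1 * T"
      using a[of n] S[of \<omega>] by (intro mult_mono power_le_one) auto
    ultimately have "\<bar>real (Suc n) * sin ((W (S \<omega>) \<omega> - x) / real (Suc n))\<bar> * exp ((a n)\<^sup>2 * S \<omega> / 2) \<le> 1 * exp (T / 2)"
      by (intro mult_mono) auto
    then show ?case unfolding Z_eq by (simp add: abs_mult)
  qed
  have "(\<integral>\<omega>. Z n \<omega> \<partial>?N) = 0" for n
  proof -
    have i: "integrable ?N (\<lambda>\<omega>. exp_mart (a n) (S \<omega>) \<omega>)"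
    proof (rule integrable_bounded_completion[OF mart(1)], intro AE_I2)
      fix \<omega> show "norm (exp_mart (a n) (S \<omega>) \<omega>) \<le> exp ((a n)\<^sup>2 * T / 2)"
        unfolding norm_exp_mart exp_le_cancel_iff using S by (intro divide_right_mono mult_left_mono) auto
    qed
    have "(\<integral>\<omega>. cis (- (a n * x)) * exp_mart (a n) (S \<omega>) \<omega> \<partial>?N) = cis (- (a n * x)) * cis (a n * x)"
      by (subst integral_mult_right_zero) (simp only: mart(2))
    also have "\<dots> = 1" by (simp add: cis_mult)
    finally have "Im (\<integral>\<omega>. cis (- (a n * x)) * exp_mart (a n) (S \<omega>) \<omega> \<partial>?N) = 0" by simp
    then show ?thesis unfolding Z_def
      by (subst integral_mult_right_zero, subst integral_Im) (use i in auto)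
  qed
  moreover have "(\<lambda>n. \<integral>\<omega>. Z n \<omega> \<partial>?N) \<longlonglongrightarrow> (\<integral>\<omega>. W (S \<omega>) \<omega> - x \<partial>?N)"
    by (rule integral_dominated_convergence[OF meas Z_meas, of "\<lambda>_. exp (T / 2)"])
      (use Z_lim bound in auto)
  ultimately have *: "(\<integral>\<omega>. W (S \<omega>) \<omega> - x \<partial>?N) = 0"
    by (simp add: LIMSEQ_const_iff)
  have "integrable ?N (\<lambda>\<omega>. W (S \<omega>) \<omega>)"
    by (rule integrable_bounded_completion[OF meas', of 1]) (use range in auto)
  then show "(\<integral>\<omega>. W (S \<omega>) \<omega> \<partial>?N) = x" using * prob_space.prob_space[OF prob_space_P] by simp
qed

text \<open>The value \<open>W 0\<close> on the null event \<open>\<tau> = \<infinity>\<close> only makes \<open>R\<close> an everywhere defined limit.\<close>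

proposition optional_stopping:
  assumes \<tau>: "\<tau> \<in> stopping_times M G P" and x: "x \<in> {0..1}"
    and exit: "\<forall>\<omega>\<in>space M. \<tau> \<omega> \<le> exit_time W \<omega>"
  defines "R \<equiv> \<lambda>\<omega>. if \<tau> \<omega> = \<infinity> then W 0 \<omega> else W (enn2real (\<tau> \<omega>)) \<omega>"
  shows "R \<in> borel_measurable (completion (P x))"
    and "(\<integral>\<omega>. R \<omega> \<partial>completion (P x)) = x"
    and "AE \<omega> in completion (P x). R \<omega> \<in> {0..1}"
proof -
  interpret prob_space "completion (P x)" by (rule prob_space.prob_space_completion[OF prob_space_P])
  let ?N = "completion (P x)"
  define S where S_eq: "S n \<omega> = enn2real (min (\<tau> \<omega>) (ennreal (real (Suc n))))" for n \<omega>
  note stopped = stopped_at_bounded_time[OF \<tau> of_nat_0_less_iff[THEN iffD2, OF zero_less_Suc] x exit, folded S_eq]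
  define Z where "Z n \<omega> = (if \<tau> \<omega> = \<infinity> then W 0 \<omega> else W (S n \<omega>) \<omega>)" for n \<omega>
  have [measurable]: "\<tau> \<in> borel_measurable ?N" by (rule stopping_time_measurable[OF \<tau>])
  have [measurable]: "W 0 \<in> borel_measurable ?N" by (rule measurable_W_completion) simp
  have [measurable]: "(\<lambda>\<omega>. W (S n \<omega>) \<omega>) \<in> borel_measurable ?N" for n by (rule stopped(1))
  have Z_meas: "Z n \<in> borel_measurable ?N" for n unfolding Z_def[abs_def] by measurable
  have Z_lim: "(\<lambda>n. Z n \<omega>) \<longlonglongrightarrow> R \<omega>" if \<omega>: "\<omega> \<in> space M" for \<omega>
  proof (cases "\<tau> \<omega> = \<infinity>")
    case False
    then obtain r where r: "0 \<le> r" "\<tau> \<omega> = ennreal r" by (metis ennreal_cases infinity_ennreal_def)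
    obtain m where m: "r \<le> real m" using real_arch_simple by blast
    \<comment> \<open>Once the truncation level passes the finite value of \<tau>, the truncated
      time no longer moves, so the limit is eventually constant.\<close>
    have "S n \<omega> = r" if "m \<le> n" for n
    proof -
      have "ennreal r \<le> ennreal (real (Suc n))" using m that by (intro ennreal_leI) simp
      then show ?thesis unfolding S_eq r(2) by (simp only: min.absorb1 enn2real_ennreal[OF r(1)])
    qed
    then have "eventually (\<lambda>n. Z n \<omega> = R \<omega>) sequentially"
      using False r unfolding eventually_sequentially Z_def R_def by auto
    then show ?thesis by (rule tendsto_eventually)
  qed (simp add: Z_def R_def)
  show meas: "R \<in> borel_measurable ?N"
    by (rule borel_measurable_LIMSEQ_metric[OF Z_meas]) (use Z_lim in \<open>simp add: space_P\<close>)
  have fin: "AE \<omega> in ?N. \<tau> \<omega> \<noteq> \<infinity>"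
    using AE_completion[OF exit_time_finite] AE_space
  proof eventually_elim
    case (elim \<omega>)
    then show ?case using exit by (auto simp: space_P)
  qed
  have W0: "AE \<omega> in ?N. W 0 \<omega> = x" using start AE_completion by blast
  have Z_range: "AE \<omega> in ?N. Z n \<omega> \<in> {0..1}" for n
    using stopped(3)[of n] W0 by eventually_elim (use x in \<open>auto simp: Z_def\<close>)
  then have "AE \<omega> in ?N. \<forall>n. Z n \<omega> \<in> {0..1}" by (simp add: AE_all_countable)
  then show "AE \<omega> in ?N. R \<omega> \<in> {0..1}" using AE_space
  proof eventually_elim
    case (elim \<omega>)
    then have \<omega>: "\<omega> \<in> space M" by (simp add: space_P)
    have "closed {0..1::real}" by simp
    then show ?case using Lim_in_closed_set[OF _ always_eventually _ Z_lim[OF \<omega>]] elim(1) by auto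
  qed
  have "(\<integral>\<omega>. Z n \<omega> \<partial>?N) = x" for n
  proof -
    have "(\<integral>\<omega>. Z n \<omega> \<partial>?N) = (\<integral>\<omega>. W (S n \<omega>) \<omega> \<partial>?N)"
      by (rule integral_cong_AE[OF Z_meas]) (use fin in \<open>auto simp: Z_def elim: eventually_mono\<close>)
    then show ?thesis using stopped(2) by simp
  qed
  moreover have Z_norm: "AE \<omega> in ?N. norm (Z n \<omega>) \<le> 1" for n using Z_range[of n] by eventually_elim auto
  have "(\<lambda>n. \<integral>\<omega>. Z n \<omega> \<partial>?N) \<longlonglongrightarrow> (\<integral>\<omega>. R \<omega> \<partial>?N)"
    by (rule integral_dominated_convergence[OF meas Z_meas, of "\<lambda>_. 1"])
      (use Z_lim Z_norm in \<open>auto intro!: AE_I2 simp: space_P\<close>)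
  ultimately show "(\<integral>\<omega>. R \<omega> \<partial>?N) = x" by (simp add: LIMSEQ_const_iff)
qed

end

section \<open>Payoffs against a hitting time\<close>

text \<open>Every subset of a null set is measurable in the completion. This lets the reward,
  defined through the killed process, inherit measurability from a plain function of the stopped
  position.\<close>

lemma borel_measurable_completion_cong_AE:
  fixes f g :: "'a \<Rightarrow> 'b::topological_space"
  assumes g: "g \<in> borel_measurable (completion N)" and eq: "AE x in completion N. f x = g x"
  shows "f \<in> borel_measurable (completion N)"
proof (rule measurableI)
  fix B :: "'b set" assume B: "B \<in> sets borel"
  obtain Z where Z: "Z \<in> null_sets (completion N)" "\<And>x. x \<in> space (completion N) - Z \<Longrightarrow> f x = g x"
    using AE_E3[OF eq] by metis
  have "f -` B \<inter> space (completion N) =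
      ((g -` B \<inter> space (completion N)) - Z) \<union> (f -` B \<inter> space (completion N) \<inter> Z)"
    using Z(2) by auto
  moreover have "g -` B \<inter> space (completion N) \<in> sets (completion N)" using g B by (rule measurable_sets)
  moreover have "f -` B \<inter> space (completion N) \<inter> Z \<in> sets (completion N)"
    by (rule completion.complete[OF _ Z(1)]) auto
  ultimately show "f -` B \<inter> space (completion N) \<in> sets (completion N)"
    using Z(1) by (metis null_setsD2 sets.Diff sets.Un)
qed simp

lemma hitting_time_in_absorbing:
  assumes "continuous_on {0..} (\<lambda>t. W t \<omega>)" "closed A" "hitting_time W A \<omega> = ennreal r" "0 \<le> r"
  shows "W r \<omega> \<in> absorbing A"
  using assms(1,2)
proof (cases rule: hitting_time_cases)
  case never
  then show ?thesis using assms(3) by simp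
next
  case (first t0)
  then show ?thesis using assms(3,4) by simp
qed

lemma admissible_rewardsD:
  assumes "admissible_rewards f g h"
  shows "continuous_on {0..1} f" "continuous_on {0..1} g" "continuous_on {0..1} h"
    and "f 0 = 0" "f 1 = 0" "g 0 = 0" "g 1 = 0" "h 0 = 0" "h 1 = 0"
    and "x \<in> {0..1} \<Longrightarrow> f x \<le> h x" "x \<in> {0..1} \<Longrightarrow> h x \<le> g x"
  using assms unfolding admissible_rewards_def by auto

context brownian_motion_family
begin

context
  fixes f g h :: "real \<Rightarrow> real" and A :: "real set" and \<tau> :: "'a \<Rightarrow> ennreal" and x :: real
  assumes adm: "admissible_rewards f g h" and A: "closed A"
    and \<tau>: "\<tau> \<in> stopping_times M G P" and x: "x \<in> {0..1}"
begin

abbreviation (input) "reward_at \<omega> \<equiv>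
  (if \<tau> \<omega> < hitting_time W A \<omega> then ext_cemetery f (killed W (\<tau> \<omega>) \<omega>)
   else if hitting_time W A \<omega> < \<tau> \<omega> then ext_cemetery g (killed W (hitting_time W A \<omega>) \<omega>)
   else ext_cemetery h (killed W (\<tau> \<omega>) \<omega>))"

text \<open>The game ends at \<sigma>, the minimum of both times, which is below the exit time and
  hence almost surely finite. An affine function of \<open>W\<close> at \<sigma> has expectation
  \<open>p + q * x\<close>, so it suffices to compare rewards with it at the end of the
  game.\<close>

lemma payoff_expectation:
  assumes bound: "AE \<omega> in completion (P x). \<forall>r\<ge>0.
    ennreal r = min (\<tau> \<omega>) (hitting_time W A \<omega>) \<longrightarrow>
    (if \<tau> \<omega> < hitting_time W A \<omega> then f (W r \<omega>)
     else if hitting_time W A \<omega> < \<tau> \<omega> then g (W r \<omega>) else h (W r \<omega>)) \<le> p + q * W r \<omega>"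
  shows "payoff P W f g h x \<tau> (hitting_time W A) \<le> p + q * x"
    and "(AE \<omega> in completion (P x). \<forall>r\<ge>0.
    ennreal r = min (\<tau> \<omega>) (hitting_time W A \<omega>) \<longrightarrow>
    (if \<tau> \<omega> < hitting_time W A \<omega> then f (W r \<omega>)
     else if hitting_time W A \<omega> < \<tau> \<omega> then g (W r \<omega>) else h (W r \<omega>)) = p + q * W r \<omega>) \<Longrightarrow>
     payoff P W f g h x \<tau> (hitting_time W A) = p + q * x"
proof -
  let ?N = "completion (P x)"
  interpret prob_space ?N by (rule prob_space.prob_space_completion[OF prob_space_P])
  let ?D = "hitting_time W A"
  define \<sigma> where "\<sigma> \<omega> = min (\<tau> \<omega>) (?D \<omega>)" for \<omega>
  define R where R_eq: "R \<omega> = (if \<sigma> \<omega> = \<infinity> then W 0 \<omega> else W (enn2real (\<sigma> \<omega>)) \<omega>)" for \<omega>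
  have D: "?D \<in> stopping_times M G P" by (rule hitting_time_stopping_time[OF A])
  have \<sigma>: "\<sigma> \<in> stopping_times M G P"
    unfolding \<sigma>_def[abs_def] by (rule stopping_times_min[OF \<tau> D])
  have exit: "\<forall>\<omega>\<in>space M. \<sigma> \<omega> \<le> exit_time W \<omega>"
    unfolding \<sigma>_def
    using hitting_time_le_exit_time[of W, OF continuous_paths A] by (auto intro: min.coboundedI2)
  note opt = optional_stopping[OF \<sigma> x exit, folded R_eq]
  have R_meas: "R \<in> borel_measurable ?N" using opt(1) by simp
  have [measurable]: "\<tau> \<in> borel_measurable ?N" "?D \<in> borel_measurable ?N"
    using stopping_time_measurable \<tau> D by auto
  \<comment> \<open>The rewards are continuous only on the unit interval; clamping the argument
    gives a continuous function on the line and changes nothing almost surely.\<close>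
  have clamp: "(\<lambda>\<omega>. \<phi> (max 0 (min 1 (R \<omega>)))) \<in> borel_measurable ?N" if "continuous_on {0..1} \<phi>" for \<phi> :: "real \<Rightarrow> real"
  proof (rule borel_measurable_continuous_on[OF _ R_meas])
    show "continuous_on UNIV (\<lambda>y::real. \<phi> (max 0 (min 1 y)))"
      by (rule continuous_on_compose2[OF that]) (auto intro!: continuous_intros)
  qed
  note [measurable] = clamp[OF admissible_rewardsD(1)[OF adm]] clamp[OF admissible_rewardsD(2)[OF adm]]
    clamp[OF admissible_rewardsD(3)[OF adm]]
  define Y where "Y \<omega> = (if \<tau> \<omega> < ?D \<omega> then f (max 0 (min 1 (R \<omega>)))
     else if ?D \<omega> < \<tau> \<omega> then g (max 0 (min 1 (R \<omega>))) else h (max 0 (min 1 (R \<omega>))))" for \<omega>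
  have Y_meas: "Y \<in> borel_measurable ?N" unfolding Y_def[abs_def] by measurable
  have W0: "AE \<omega> in ?N. W 0 \<omega> = x" using start AE_completion by blast
  have fin: "AE \<omega> in ?N. exit_time W \<omega> < \<infinity>" using AE_completion[OF exit_time_finite] .
  have good: "AE \<omega> in ?N. \<exists>r\<ge>0. ennreal r = \<sigma> \<omega> \<and> R \<omega> = W r \<omega> \<and> W r \<omega> \<in> {0..1} \<and> reward_at \<omega> = 
      (if \<tau> \<omega> < ?D \<omega> then f (W r \<omega>) else if ?D \<omega> < \<tau> \<omega> then g (W r \<omega>) else h (W r \<omega>))"
    using W0 fin AE_space
  proof eventually_elim
    case (elim \<omega>)
    then have \<omega>: "\<omega> \<in> space M" by (simp add: space_P)
    have start: "W 0 \<omega> \<in> {0..1}" using elim(1) x by simp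
    have "\<sigma> \<omega> < \<infinity>" using exit \<omega> elim(2) by (auto intro: order_le_less_trans)
    then obtain r where r: "0 \<le> r" "\<sigma> \<omega> = ennreal r" by (metis ennreal_cases infinity_ennreal_def less_irrefl)
    have rexit: "ennreal r \<le> exit_time W \<omega>" using exit \<omega> r(2) by auto
    note k = ext_cemetery_killed[of W \<omega>, OF continuous_paths[OF \<omega>] start _ _ r(1) rexit]
    have "R \<omega> = W r \<omega>" unfolding R_eq r(2) using r(1) by simp
    moreover have "W r \<omega> \<in> {0..1}"
      by (rule path_until_exit(3)[of W \<omega>, OF continuous_paths[OF \<omega>] start r(1) rexit])
    moreover have "reward_at \<omega> = 
      (if \<tau> \<omega> < ?D \<omega> then f (W r \<omega>) else if ?D \<omega> < \<tau> \<omega> then g (W r \<omega>) else h (W r \<omega>))"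
    proof -
      have "\<tau> \<omega> < ?D \<omega> \<Longrightarrow> \<tau> \<omega> = ennreal r" "?D \<omega> < \<tau> \<omega> \<Longrightarrow> ?D \<omega> = ennreal r"
        "\<not> \<tau> \<omega> < ?D \<omega> \<Longrightarrow> \<not> ?D \<omega> < \<tau> \<omega> \<Longrightarrow> \<tau> \<omega> = ennreal r"
        using r(2) unfolding \<sigma>_def by (auto simp: min_def split: if_splits)
      then show ?thesis
        using k[OF admissible_rewardsD(4,5)[OF adm]] k[OF admissible_rewardsD(6,7)[OF adm]]
          k[OF admissible_rewardsD(8,9)[OF adm]] by (auto simp del: not_less)
    qed
    ultimately show ?case using r(1) r(2)[symmetric] by (intro exI[of _ r] conjI)
  qed
  have reward_Y: "AE \<omega> in ?N. reward_at \<omega> = Y \<omega>"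
    using good
  proof eventually_elim
    case (elim \<omega>)
    then obtain r where r: "R \<omega> = W r \<omega>" "W r \<omega> \<in> {0..1}" "reward_at \<omega> = 
      (if \<tau> \<omega> < ?D \<omega> then f (W r \<omega>) else if ?D \<omega> < \<tau> \<omega> then g (W r \<omega>) else h (W r \<omega>))" by blast
    have "max 0 (min 1 (R \<omega>)) = W r \<omega>" using r(1,2) by auto
    then show ?case unfolding Y_def r(3) by simp
  qed
  have reward_meas: "(\<lambda>\<omega>. reward_at \<omega>) \<in> borel_measurable ?N"
    by (rule borel_measurable_completion_cong_AE[OF Y_meas reward_Y])
  have payoff_eq: "payoff P W f g h x \<tau> ?D = (\<integral>\<omega>. reward_at \<omega> \<partial>?N)"
    unfolding payoff_def expect_def ..
  have R_int: "integrable ?N R"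
    by (rule integrable_bounded_completion[OF R_meas, of 1]) (use opt(3) in auto)
  have R_lin: "(\<integral>\<omega>. p + q * R \<omega> \<partial>?N) = p + q * x"
    using R_int opt(2) prob_space.prob_space[OF prob_space_P] by simp
  show "payoff P W f g h x \<tau> ?D = p + q * x" if *: "(AE \<omega> in completion (P x). \<forall>r\<ge>0.
    ennreal r = min (\<tau> \<omega>) (hitting_time W A \<omega>) \<longrightarrow>
    (if \<tau> \<omega> < hitting_time W A \<omega> then f (W r \<omega>)
     else if hitting_time W A \<omega> < \<tau> \<omega> then g (W r \<omega>) else h (W r \<omega>)) = p + q * W r \<omega>)"
  proof -
    have "AE \<omega> in ?N. reward_at \<omega> = p + q * R \<omega>"
      using good * unfolding \<sigma>_def by eventually_elim force
    then have "(\<integral>\<omega>. reward_at \<omega> \<partial>?N) = (\<integral>\<omega>. p + q * R \<omega> \<partial>?N)"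
      using reward_meas R_meas by (intro integral_cong_AE) auto
    then show ?thesis unfolding payoff_eq R_lin .
  qed
  show "payoff P W f g h x \<tau> ?D \<le> p + q * x"
  proof -
    have le: "AE \<omega> in ?N. reward_at \<omega> \<le> p + q * R \<omega>"
      using good bound unfolding \<sigma>_def by eventually_elim force
    obtain K where K: "\<And>y. y \<in> {0..1} \<Longrightarrow> \<bar>f y\<bar> \<le> K \<and> \<bar>g y\<bar> \<le> K \<and> \<bar>h y\<bar> \<le> K"
    proof -
      have "bounded (f ` {0..1} \<union> g ` {0..1} \<union> h ` {0..1})"
        using admissible_rewardsD(1-3)[OF adm]
        by (auto intro!: compact_imp_bounded compact_continuous_image)
      then obtain K where "\<forall>v\<in>f ` {0..1} \<union> g ` {0..1} \<union> h ` {0..1}. norm v \<le> K"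
        unfolding bounded_iff by blast
      then show thesis by (intro that[of K]) auto
    qed
    have "AE \<omega> in ?N. norm (reward_at \<omega>) \<le> K"
      using good
    proof eventually_elim
      case (elim \<omega>)
      then obtain r where r: "W r \<omega> \<in> {0..1}" "reward_at \<omega> = 
        (if \<tau> \<omega> < ?D \<omega> then f (W r \<omega>) else if ?D \<omega> < \<tau> \<omega> then g (W r \<omega>) else h (W r \<omega>))" by blast
      show ?case unfolding r(2) using K[OF r(1)] by simp
    qed
    then have "integrable ?N (\<lambda>\<omega>. reward_at \<omega>)" by (rule integrable_bounded_completion[OF reward_meas])
    then have "(\<integral>\<omega>. reward_at \<omega> \<partial>?N) \<le> (\<integral>\<omega>. p + q * R \<omega> \<partial>?N)"
      using le R_int by (intro integral_mono_AE) auto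
    then show ?thesis unfolding payoff_eq R_lin .
  qed
qed

end

text \<open>Until the opponent stops, the path stays strictly inside the component of
  \<open>x\<close>, where only \<open>f\<close> can be earned. When the opponent stops, the path is
  at an end and the reward is \<open>g\<close>, or \<open>h\<close> at a tie, which is no
  larger.\<close>

lemma payoff_le:
  assumes adm: "admissible_rewards f g h" and A: "closed A" and \<tau>: "\<tau> \<in> stopping_times M G P"
    and x: "0 \<le> \<alpha>" "\<alpha> \<le> x" "x \<le> \<beta>" "\<beta> \<le> 1"
    and ends: "\<alpha> \<in> absorbing A" "\<beta> \<in> absorbing A" "absorbing A \<inter> {\<alpha><..<\<beta>} = {}"
    and f_le: "\<And>w. w \<in> {\<alpha><..<\<beta>} \<Longrightarrow> f w \<le> p + q * w"
    and g_le: "g \<alpha> \<le> p + q * \<alpha>" "g \<beta> \<le> p + q * \<beta>"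
  shows "payoff P W f g h x \<tau> (hitting_time W A) \<le> p + q * x"
proof (rule payoff_expectation(1)[OF adm A \<tau>])
  have W0: "AE \<omega> in completion (P x). W 0 \<omega> = x" using start AE_completion by blast
  then show "AE \<omega> in completion (P x). \<forall>r\<ge>0.
    ennreal r = min (\<tau> \<omega>) (hitting_time W A \<omega>) \<longrightarrow>
    (if \<tau> \<omega> < hitting_time W A \<omega> then f (W r \<omega>)
     else if hitting_time W A \<omega> < \<tau> \<omega> then g (W r \<omega>) else h (W r \<omega>)) \<le> p + q * W r \<omega>"
    using AE_space
  proof eventually_elim
    case (elim \<omega>)
    then have \<omega>: "\<omega> \<in> space M" by (simp add: space_P)
    note loc = hitting_time_location[of W \<omega>, OF continuous_paths[OF \<omega>] A _ _ ends]
    show ?case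
    proof (intro allI impI)
      fix r :: real assume r: "0 \<le> r" "ennreal r = min (\<tau> \<omega>) (hitting_time W A \<omega>)"
      show "(if \<tau> \<omega> < hitting_time W A \<omega> then f (W r \<omega>)
        else if hitting_time W A \<omega> < \<tau> \<omega> then g (W r \<omega>) else h (W r \<omega>)) \<le> p + q * W r \<omega>"
      proof (cases "\<tau> \<omega> < hitting_time W A \<omega>")
        case True
        then have "ennreal r < hitting_time W A \<omega>" using r(2) by (simp add: min_def)
        then show ?thesis using True loc(1)[OF _ _ r(1)] elim(1) x f_le by simp
      next
        case False
        then have "ennreal r = hitting_time W A \<omega>" using r(2) by (simp add: min_def)
        then have w: "W r \<omega> \<in> {\<alpha>, \<beta>}" using loc(2)[OF _ _ r(1)] elim(1) x by simp
        then have "g (W r \<omega>) \<le> p + q * W r \<omega>" "W r \<omega> \<in> {0..1}" using g_le x by auto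
        then show ?thesis using False admissible_rewardsD(11)[OF adm, of "W r \<omega>"] by auto
      qed
    qed
  qed
qed (use x in auto)

text \<open>Disjoint regions exclude a tie inside the unit interval, so whose region contains the
  end point decides between \<open>g\<close> and \<open>f\<close>. At 0 and 1 all rewards vanish, so
  a tie caused by the exit is harmless.\<close>

lemma payoff_hitting_times:
  assumes adm: "admissible_rewards f g h" and A: "closed A" and B: "closed B" and disj: "A \<inter> B = {}"
    and x: "0 \<le> \<alpha>" "\<alpha> \<le> x" "x \<le> \<beta>" "\<beta> \<le> 1"
    and ends: "\<alpha> \<in> absorbing (A \<union> B)" "\<beta> \<in> absorbing (A \<union> B)" "absorbing (A \<union> B) \<inter> {\<alpha><..<\<beta>} = {}"
    and reward: "p + q * \<alpha> = (if \<alpha> \<in> A then g \<alpha> else f \<alpha>)" "p + q * \<beta> = (if \<beta> \<in> A then g \<beta> else f \<beta>)"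
  shows "payoff P W f g h x (hitting_time W B) (hitting_time W A) = p + q * x"
proof -
  let ?\<tau> = "hitting_time W B" and ?D = "hitting_time W A"
  have W0: "AE \<omega> in completion (P x). W 0 \<omega> = x" using start AE_completion by blast
  then have eq: "AE \<omega> in completion (P x). \<forall>r\<ge>0. ennreal r = min (?\<tau> \<omega>) (?D \<omega>) \<longrightarrow>
    (if ?\<tau> \<omega> < ?D \<omega> then f (W r \<omega>) else if ?D \<omega> < ?\<tau> \<omega> then g (W r \<omega>) else h (W r \<omega>)) = p + q * W r \<omega>"
    using AE_space
  proof eventually_elim
    case (elim \<omega>)
    then have \<omega>: "\<omega> \<in> space M" by (simp add: space_P)
    note cont = continuous_paths[OF \<omega>]
    show ?case
    proof (intro allI impI)
      fix r :: real assume r: "0 \<le> r" "ennreal r = min (?\<tau> \<omega>) (?D \<omega>)"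
      define e where "e = W r \<omega>"
      have "ennreal r = hitting_time W (A \<union> B) \<omega>"
        unfolding hitting_time_Un[of W \<omega>, OF cont A B] using r(2) by (simp add: min.commute)
      then have e: "e \<in> {\<alpha>, \<beta>}" unfolding e_def
        using hitting_time_location(2)[of W \<omega>, OF cont closed_Un[OF A B] _ _ ends r(1)] elim(1) x by simp
      have val: "p + q * e = (if e \<in> A then g e else f e)" using e reward by auto
      have in_A: "?D \<omega> = ennreal r \<Longrightarrow> e \<in> absorbing A" and in_B: "?\<tau> \<omega> = ennreal r \<Longrightarrow> e \<in> absorbing B"
        unfolding e_def using hitting_time_in_absorbing[of W \<omega>, OF cont] A B r(1) by blast+
      have le_A: "?D \<omega> \<le> ennreal r" if "e \<in> A"
        unfolding hitting_time_le_iff[of W \<omega>, OF cont A r(1)]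
        using that r(1) by (auto simp: absorbing_def e_def)
      have le_B: "?\<tau> \<omega> \<le> ennreal r" if "e \<in> B"
        unfolding hitting_time_le_iff[of W \<omega>, OF cont B r(1)]
        using that r(1) by (auto simp: absorbing_def e_def)
      have ge: "ennreal r \<le> ?\<tau> \<omega>" "ennreal r \<le> ?D \<omega>" using r(2) by auto
      show "(if ?\<tau> \<omega> < ?D \<omega> then f (W r \<omega>) else if ?D \<omega> < ?\<tau> \<omega> then g (W r \<omega>) else h (W r \<omega>)) = p + q * W r \<omega>"
        unfolding e_def[symmetric]
      proof (cases "e \<in> {0<..<1}")
        case False
        then have "e = 0 \<or> e = 1" using e x by auto
        then show "(if ?\<tau> \<omega> < ?D \<omega> then f e else if ?D \<omega> < ?\<tau> \<omega> then g e else h e) = p + q * e"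
          unfolding val using admissible_rewardsD(4-9)[OF adm] by auto
      next
        case True
        have "e \<in> absorbing (A \<union> B)" using e ends by auto
        then have "e \<in> A \<or> e \<in> B" using True by (auto simp: absorbing_def)
        then show "(if ?\<tau> \<omega> < ?D \<omega> then f e else if ?D \<omega> < ?\<tau> \<omega> then g e else h e) = p + q * e"
        proof
          assume "e \<in> A"
          then have "?D \<omega> = ennreal r" using le_A ge by (simp add: antisym)
          moreover have "?\<tau> \<omega> \<noteq> ennreal r" using in_B \<open>e \<in> A\<close> disj True by (auto simp: absorbing_def)
          ultimately have "?D \<omega> < ?\<tau> \<omega>" using ge by simp
          then show ?thesis unfolding val using \<open>e \<in> A\<close> by (auto dest: less_asym)
        next
          assume "e \<in> B"
          then have "?\<tau> \<omega> = ennreal r" using le_B ge by (simp add: antisym)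
          moreover have "?D \<omega> \<noteq> ennreal r" using in_A \<open>e \<in> B\<close> disj True by (auto simp: absorbing_def)
          ultimately have "?\<tau> \<omega> < ?D \<omega>" using ge by simp
          moreover have "e \<notin> A" using disj \<open>e \<in> B\<close> by blast
          ultimately show ?thesis unfolding val by simp
        qed
      qed
    qed
  qed
  then have "AE \<omega> in completion (P x). \<forall>r\<ge>0. ennreal r = min (?\<tau> \<omega>) (?D \<omega>) \<longrightarrow>
    (if ?\<tau> \<omega> < ?D \<omega> then f (W r \<omega>) else if ?D \<omega> < ?\<tau> \<omega> then g (W r \<omega>) else h (W r \<omega>)) \<le> p + q * W r \<omega>"
    by eventually_elim simp
  then show ?thesis
    using payoff_expectation(2)[OF adm A hitting_time_stopping_time[OF B] _ _ eq] x by simp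
qed

end

section \<open>Affine majorants\<close>

lemma convex_on_le_affine:
  fixes f :: "real \<Rightarrow> real"
  assumes f: "convex_on {s..t} f" and ends: "f s \<le> p + q * s" "f t \<le> p + q * t" and w: "w \<in> {s..t}"
  shows "f w \<le> p + q * w"
proof (cases "s = t")
  case False
  define u where "u = (w - s) / (t - s)"
  have st: "s < t" using w False by auto
  have u: "0 \<le> u" "u \<le> 1" using w st by (auto simp: u_def)
  have "u * (t - s) = w - s" using st by (simp add: u_def)
  then have weq: "w = (1 - u) * s + u * t" by (simp add: algebra_simps)
  have "f w \<le> (1 - u) * f s + u * f t"
    using convex_onD[OF f u, of s t] st unfolding weq by simp
  also have "\<dots> \<le> (1 - u) * (p + q * s) + u * (p + q * t)"
    using u ends by (intro add_mono mult_left_mono) auto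
  also have "\<dots> = p + q * w" unfolding weq by (simp add: algebra_simps)
  finally show ?thesis .
next
  case True
  then have "w = t" using w by simp
  then show ?thesis using ends(2) by simp
qed

lemma affine_le_affine:
  fixes p q :: real
  assumes "p + q * s \<le> p' + q' * s" "p + q * t \<le> p' + q' * t" "w \<in> {s..t}"
  shows "p + q * w \<le> p' + q' * w"
proof (rule convex_on_le_affine[OF _ assms])
  show "convex_on {s..t} (\<lambda>w. p + q * w)"
    by (intro convex_onI) (auto simp: algebra_simps)
qed

lemma concave_on_supergradient:
  fixes f :: "real \<Rightarrow> real"
  assumes "concave_on {s..t} f" "s < x" "x < t"
  obtains q where "\<And>w. w \<in> {s..t} \<Longrightarrow> f w \<le> f x + q * (w - x)"
proof -
  have c: "convex_on {s..t} (\<lambda>w. - f w)" using assms(1) by (simp add: concave_on_def)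
  have x: "x \<in> interior {s..t}" using assms(2,3) by simp
  show thesis
    by (rule that[of "- Inf ((\<lambda>t. (- f x - - f t) / (x - t)) ` ({x<..} \<inter> {s..t}))"])
      (use convex_le_Inf_differential[OF c x] in force)
qed

text \<open>The line \<open>p + m * w\<close> is below the supporting line at \<open>s\<close> and
  above it at \<open>x\<close>, so it is at least as steep and stays below further left. Thus bounds
  by a chord pass on to the supporting line at an interior point of the stopping region.\<close>

lemma supporting_line_left:
  fixes f :: "real \<Rightarrow> real"
  assumes "f s \<le> f x + q * (s - x)" "s < x" "p + m * s \<le> f s" "f x \<le> p + m * x" "w \<le> s"
  shows "p + m * w \<le> f x + q * (w - x)"
proof -
  have "q * (x - s) \<le> m * (x - s)" using assms(1,3,4) by (simp add: algebra_simps)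
  then have "q \<le> m" using assms(2) by simp
  then have "q * (s - w) \<le> m * (s - w)" using assms(5) by (intro mult_right_mono) auto
  then show ?thesis using assms(1,3) by (simp add: algebra_simps)
qed

lemma supporting_line_right:
  fixes f :: "real \<Rightarrow> real"
  assumes "f t \<le> f x + q * (t - x)" "x < t" "p + m * t \<le> f t" "f x \<le> p + m * x" "t \<le> w"
  shows "p + m * w \<le> f x + q * (w - x)"
proof -
  have "m * (t - x) \<le> q * (t - x)" using assms(1,3,4) by (simp add: algebra_simps)
  then have "m \<le> q" using assms(2) by simp
  then have "m * (w - t) \<le> q * (w - t)" using assms(5) by (intro mult_right_mono) auto
  then show ?thesis using assms(1,3) by (simp add: algebra_simps)
qed

text \<open>In the next lemma \<open>k * w\<close> is the reward for waiting and \<open>\<ell>\<^sub>1\<close>, \<open>\<ell>\<^sub>2\<close> are the boundaries of the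
  stopping region of the first player.\<close>

lemma concave_majorant_two_boundaries:
  fixes f :: "real \<Rightarrow> real"
  assumes order: "0 < a\<^sub>1" "a\<^sub>1 \<le> l\<^sub>1" "l\<^sub>1 \<le> l\<^sub>2" "l\<^sub>2 \<le> a\<^sub>2" "a\<^sub>2 < r"
    and f: "convex_on {0..a\<^sub>1} f" "concave_on {a\<^sub>1..a\<^sub>2} f" "convex_on {a\<^sub>2..r} f"
    and ends: "f 0 = 0" "f r \<le> k * r"
    and opt\<^sub>1: "\<And>w. w \<in> {a\<^sub>1..l\<^sub>2} \<Longrightarrow> f w / w \<le> f l\<^sub>1 / l\<^sub>1"
    and opt\<^sub>2: "\<And>w. w \<in> {l\<^sub>1..a\<^sub>2} \<Longrightarrow> (f w - k * w) / (r - w) \<le> (f l\<^sub>2 - k * l\<^sub>2) / (r - l\<^sub>2)"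
    and nonneg: "k * l\<^sub>2 \<le> f l\<^sub>2"
    and x: "x \<in> {0..r}"
  obtains p q where "\<And>w. w \<in> {0..r} \<Longrightarrow> f w \<le> p + q * w" "0 \<le> p" "k * r \<le> p + q * r"
    and "x \<le> l\<^sub>1 \<Longrightarrow> p = 0 \<and> p + q * l\<^sub>1 = f l\<^sub>1"
    and "l\<^sub>1 < x \<Longrightarrow> x < l\<^sub>2 \<Longrightarrow> p + q * x = f x"
    and "l\<^sub>1 < x \<Longrightarrow> l\<^sub>2 \<le> x \<Longrightarrow> p + q * l\<^sub>2 = f l\<^sub>2 \<and> p + q * r = k * r"
proof -
  \<comment> \<open>Two lines govern the proof: \<open>m * w\<close> joins the origin to the graph
    at \<open>l\<^sub>1\<close>, and \<open>c * r + (k - c) * w\<close> joins the graph at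
    \<open>l\<^sub>2\<close> to the point \<open>(r, k * r)\<close>. Optimality puts
    \<open>f\<close> below each on part of the concave stretch.\<close>
  define m where "m = f l\<^sub>1 / l\<^sub>1"
  define c where "c = (f l\<^sub>2 - k * l\<^sub>2) / (r - l\<^sub>2)"
  have m_l1: "m * l\<^sub>1 = f l\<^sub>1" and c_l2: "c * (r - l\<^sub>2) = f l\<^sub>2 - k * l\<^sub>2"
    using order by (simp_all add: m_def c_def)
  have c0: "0 \<le> c" using nonneg order by (simp add: c_def)
  have le_m: "f w \<le> 0 + m * w" if "w \<in> {a\<^sub>1..l\<^sub>2}" for w
    using opt\<^sub>1[OF that] that order by (simp add: m_def[symmetric] pos_divide_le_eq)
  have le_c: "f w \<le> c * r + (k - c) * w" if "w \<in> {l\<^sub>1..a\<^sub>2}" for w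
    using opt\<^sub>2[OF that] that order by (simp add: c_def[symmetric] pos_divide_le_eq algebra_simps)
  have c_l2': "c * r + (k - c) * l\<^sub>2 = f l\<^sub>2" using c_l2 by (simp add: algebra_simps)
  \<comment> \<open>Together with \<open>c0\<close> this is where stopping at
    \<open>l\<^sub>2\<close> being no worse than waiting enters. It orders the two lines at
    \<open>r\<close>, as \<open>c0\<close> orders them at 0.\<close>
  have mk: "k \<le> m"
  proof -
    have "f l\<^sub>2 \<le> 0 + m * l\<^sub>2" by (rule le_m) (use order in auto)
    then have "k * l\<^sub>2 \<le> m * l\<^sub>2" using nonneg by linarith
    then show ?thesis by (rule mult_right_le_imp_le) (use order in auto)
  qed
  have le_c_right: "f w \<le> c * r + (k - c) * w" if "w \<in> {l\<^sub>1..r}" for w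
  proof (cases "w \<le> a\<^sub>2")
    case True
    then show ?thesis using le_c that by auto
  next
    case False
    have "f a\<^sub>2 \<le> c * r + (k - c) * a\<^sub>2" by (rule le_c) (use order in auto)
    moreover have "f r \<le> c * r + (k - c) * r" using ends(2) by (simp add: algebra_simps)
    ultimately show ?thesis by (rule convex_on_le_affine[OF f(3)]) (use False that in auto)
  qed
  have le_m_left: "f w \<le> 0 + m * w" if "w \<in> {0..l\<^sub>2}" for w
  proof (cases "a\<^sub>1 \<le> w")
    case True
    then show ?thesis using le_m that by auto
  next
    case False
    show ?thesis
      by (rule convex_on_le_affine[OF f(1) _ le_m]) (use False ends order that in auto)
  qed
  have c_le_m: "c * r + (k - c) * w \<le> 0 + m * w" if "w \<in> {l\<^sub>2..r}" for w
    by (rule affine_le_affine[OF _ _ that])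
      (use c_l2' le_m[of l\<^sub>2] order mk in \<open>auto simp: algebra_simps intro: mult_right_mono\<close>)
  have m_le_c: "0 + m * w \<le> c * r + (k - c) * w" if "w \<in> {0..l\<^sub>1}" for w
    by (rule affine_le_affine[OF _ _ that])
      (use m_l1 le_c[of l\<^sub>1] order c0 in auto)
  \<comment> \<open>Each line dominates \<open>f\<close> on its own side, and beyond the other
    boundary it dominates the other line; hence both dominate \<open>f\<close> on all of
    \<open>{0..r}\<close>.\<close>
  have f_le_m: "f w \<le> 0 + m * w" if "w \<in> {0..r}" for w
    using le_m_left[of w] le_c_right[of w] c_le_m[of w] that order by (cases "w \<le> l\<^sub>2") fastforce+
  have f_le_c: "f w \<le> c * r + (k - c) * w" if "w \<in> {0..r}" for w
    using le_m_left[of w] le_c_right[of w] m_le_c[of w] that order by (cases "l\<^sub>1 \<le> w") fastforce+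
  consider "x \<le> l\<^sub>1" | "l\<^sub>1 < x" "x < l\<^sub>2" | "l\<^sub>1 < x" "l\<^sub>2 \<le> x" by linarith
  then show thesis
  proof cases
    case 1
    then show ?thesis
      by (intro that[of 0 m]) (use f_le_m m_l1 mk order in \<open>auto intro: mult_right_mono\<close>)
  next
    case 3
    then show ?thesis
      by (intro that[of "c * r" "k - c"]) (use f_le_c c_l2' c0 order in \<open>auto simp: algebra_simps\<close>)
  next
    case 2
    have "concave_on {l\<^sub>1..l\<^sub>2} f"
      using f(2) order unfolding concave_on_def by (auto intro: convex_on_subset)
    then obtain q where q: "\<And>w. w \<in> {l\<^sub>1..l\<^sub>2} \<Longrightarrow> f w \<le> f x + q * (w - x)"
      using concave_on_supergradient 2 by blast
    have left: "0 + m * w \<le> f x + q * (w - x)" if "w \<le> l\<^sub>1" for w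
      by (rule supporting_line_left[where s=l\<^sub>1]) (use that q[of l\<^sub>1] 2 m_l1 le_m_left[of x] order in auto)
    have right: "c * r + (k - c) * w \<le> f x + q * (w - x)" if "l\<^sub>2 \<le> w" for w
      by (rule supporting_line_right[where t=l\<^sub>2]) (use that q[of l\<^sub>2] 2 c_l2' f_le_c[of x] order in auto)
    have "f w \<le> (f x - q * x) + q * w" if "w \<in> {0..r}" for w
    proof -
      have "f w \<le> f x + q * (w - x)"
        using left[of w] right[of w] q[of w] f_le_m[OF that] f_le_c[OF that]
        by (cases "w \<le> l\<^sub>1"; cases "l\<^sub>2 \<le> w") auto
      then show ?thesis by (simp add: algebra_simps)
    qed
    moreover have "0 \<le> f x - q * x" using left[of 0] order by simp
    moreover have "k * r \<le> (f x - q * x) + q * r"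
      using right[of r] order by (simp add: algebra_simps)
    ultimately show ?thesis
      by (intro that[of "f x - q * x" q]) (use 2 in auto)
  qed
qed

text \<open>The counterpart for the second player, with \<open>j * (1 - w)\<close> as the reward for
  waiting. The line through \<open>(l, j * (1 - l))\<close> and the graph at \<open>r\<close>
  dominates \<open>f\<close>; for starting points right of \<open>r\<close> it is replaced by a
  supporting line.\<close>

lemma concave_majorant_one_boundary:
  fixes f :: "real \<Rightarrow> real"
  assumes order: "l < b" "b \<le> r" "r \<le> 1"
    and f: "convex_on {l..b} f" "concave_on {b..1} f"
    and ends: "f l \<le> j * (1 - l)" "f 1 = 0"
    and opt: "\<And>w. w \<in> {b..1} \<Longrightarrow> (f w - j * (1 - w)) / (w - l) \<le> (f r - j * (1 - r)) / (r - l)"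
    and x: "x \<in> {l..<1}"
  obtains p q where "\<And>w. w \<in> {l..1} \<Longrightarrow> f w \<le> p + q * w" "j * (1 - l) \<le> p + q * l" "0 \<le> p + q * 1"
    and "x \<le> r \<Longrightarrow> p + q * l = j * (1 - l) \<and> p + q * r = f r"
    and "r < x \<Longrightarrow> p + q * x = f x"
proof -
  define c where "c = (f r - j * (1 - r)) / (r - l)"
  have c_r: "(j - c * l) + (c - j) * r = f r"
  proof -
    have "c * (r - l) = f r - j * (1 - r)" using order by (simp add: c_def)
    then show ?thesis by (simp add: algebra_simps)
  qed
  \<comment> \<open>The point 1 is a feasible choice whose ratio is 0, so the optimal ratio cannot
    be negative.\<close>
  have c0: "0 \<le> c" using opt[of 1] ends order by (simp add: c_def)
  have le_b: "f w \<le> (j - c * l) + (c - j) * w" if "w \<in> {b..1}" for w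
  proof -
    have "f w - j * (1 - w) \<le> c * (w - l)"
      using opt[OF that] that order by (simp add: c_def[symmetric] pos_divide_le_eq)
    then show ?thesis by (simp add: algebra_simps)
  qed
  have le: "f w \<le> (j - c * l) + (c - j) * w" if "w \<in> {l..1}" for w
  proof (cases "b \<le> w")
    case True
    then show ?thesis using le_b that by auto
  next
    case False
    have "(j - c * l) + (c - j) * l = j * (1 - l)" by (simp add: algebra_simps)
    then have "f l \<le> (j - c * l) + (c - j) * l" using ends(1) by simp
    moreover have "f b \<le> (j - c * l) + (c - j) * b" by (rule le_b) (use order in auto)
    ultimately show ?thesis by (rule convex_on_le_affine[OF f(1)]) (use False that in auto)
  qed
  show thesis
  proof (cases "x \<le> r")
    case True
    have "c * l \<le> c * 1" using c0 order by (intro mult_left_mono) auto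
    then show ?thesis using True
      by (intro that[of "j - c * l" "c - j"]) (use le c_r in \<open>auto simp: algebra_simps\<close>)
  next
    case False
    have "concave_on {r..1} f"
      using f(2) order unfolding concave_on_def by (auto intro: convex_on_subset)
    then obtain q where q: "\<And>w. w \<in> {r..1} \<Longrightarrow> f w \<le> f x + q * (w - x)"
      using concave_on_supergradient[of r 1 f x] False x by auto
    have left: "(j - c * l) + (c - j) * w \<le> f x + q * (w - x)" if "w \<le> r" for w
      by (rule supporting_line_left[where s=r]) (use that q[of r] False c_r le[of x] order x in auto)
    have "f w \<le> (f x - q * x) + q * w" if "w \<in> {l..1}" for w
    proof -
      have "f w \<le> f x + q * (w - x)"
        using left[of w] q[of w] le[OF that] that by (cases "w \<le> r") auto
      then show ?thesis by (simp add: algebra_simps)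
    qed
    moreover have "j * (1 - l) \<le> (f x - q * x) + q * l" using left[of l] order by (simp add: algebra_simps)
    moreover have "0 \<le> (f x - q * x) + q * 1"
      using q[of 1] ends order by (simp add: algebra_simps)
    ultimately show ?thesis using False by (intro that[of "f x - q * x" q]) auto
  qed
qed

section \<open>Equilibria of two-player ratio games\<close>

text \<open>The pairs of a parameter and a maximiser form an intersection of closed sets. By
  uniqueness this is the graph of a function, and a closed graph with compact range gives
  continuity.\<close>

lemma continuous_argmax:
  fixes U :: "real \<Rightarrow> real \<Rightarrow> real"
  assumes I: "compact I" "I \<noteq> {}" and J: "closed J"
    and cont: "continuous_on (J \<times> I) (\<lambda>(z, y). U y z)"
    and uniq: "\<And>z y y'. z \<in> J \<Longrightarrow> y \<in> I \<Longrightarrow> y' \<in> I \<Longrightarrow> \<forall>w\<in>I. U w z \<le> U y z \<Longrightarrow>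
      \<forall>w\<in>I. U w z \<le> U y' z \<Longrightarrow> y = y'"
  obtains \<phi> where "continuous_on J \<phi>" "\<phi> \<in> J \<rightarrow> I" "\<And>z w. z \<in> J \<Longrightarrow> w \<in> I \<Longrightarrow> U w z \<le> U (\<phi> z) z"
proof -
  have "\<exists>y\<in>I. \<forall>w\<in>I. U w z \<le> U y z" if "z \<in> J" for z
  proof (rule continuous_attains_sup[OF I])
    have "continuous_on I (\<lambda>y. (z, y))" by (intro continuous_intros)
    then have "continuous_on I (\<lambda>y. case (z, y) of (z, y) \<Rightarrow> U y z)"
      by (rule continuous_on_compose2[OF cont]) (use that in auto)
    then show "continuous_on I (\<lambda>y. U y z)" by simp
  qed
  then obtain \<phi> where \<phi>: "\<And>z. z \<in> J \<Longrightarrow> \<phi> z \<in> I" "\<And>z w. z \<in> J \<Longrightarrow> w \<in> I \<Longrightarrow> U w z \<le> U (\<phi> z) z"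
    by metis
  have closed_JI: "closed (J \<times> I)" by (rule closed_Times[OF J compact_imp_closed[OF I(1)]])
  have "closed {p \<in> J \<times> I. U w (fst p) \<le> U (snd p) (fst p)}" if "w \<in> I" for w
  proof -
    have "continuous_on (J \<times> I) (\<lambda>p. case (fst p, w) of (z, y) \<Rightarrow> U y z)"
      by (rule continuous_on_compose2[OF cont]) (use that in \<open>auto intro!: continuous_intros\<close>)
    then have c1: "continuous_on (J \<times> I) (\<lambda>p. U w (fst p))" by simp
    have c2: "continuous_on (J \<times> I) (\<lambda>p. U (snd p) (fst p))"
      using cont by (simp add: case_prod_beta)
    show ?thesis by (rule continuous_on_closed_Collect_le[OF c1 c2 closed_JI])
  qed
  then have "closed (\<Inter>w\<in>I. {p \<in> J \<times> I. U w (fst p) \<le> U (snd p) (fst p)})" by auto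
  also have "(\<Inter>w\<in>I. {p \<in> J \<times> I. U w (fst p) \<le> U (snd p) (fst p)}) = (\<lambda>z. (z, \<phi> z)) ` J"
  proof (intro equalityI subsetI)
    fix p assume p: "p \<in> (\<Inter>w\<in>I. {p \<in> J \<times> I. U w (fst p) \<le> U (snd p) (fst p)})"
    then have p': "fst p \<in> J" "snd p \<in> I" "\<forall>w\<in>I. U w (fst p) \<le> U (snd p) (fst p)" using I(2) by auto
    then have "snd p = \<phi> (fst p)" using \<phi> by (intro uniq) auto
    then show "p \<in> (\<lambda>z. (z, \<phi> z)) ` J" using p'(1) by (intro image_eqI[of _ _ "fst p"]) (auto simp: prod_eq_iff)
  qed (use \<phi> in auto)
  finally have "closed ((\<lambda>z. (z, \<phi> z)) ` J)" .
  then have "continuous_on J \<phi>" using I(1) \<phi>(1) by (intro continuous_from_closed_graph[of I]) auto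
  then show thesis using that \<phi> by auto
qed

text \<open>A maximal value \<open>v\<close> attained twice would be exceeded at the midpoint, since
  \<open>f y - \<epsilon> y\<^sup>2 - v (p + q y)\<close> is strictly concave.\<close>

lemma unique_max_perturbed_ratio:
  fixes f :: "real \<Rightarrow> real"
  assumes f: "concave_on S f" and \<epsilon>: "0 < \<epsilon>" and pos: "\<And>y. y \<in> S \<Longrightarrow> 0 < p + q * y"
    and y: "y \<in> S" "\<And>w. w \<in> S \<Longrightarrow> (f w - \<epsilon> * w\<^sup>2) / (p + q * w) \<le> (f y - \<epsilon> * y\<^sup>2) / (p + q * y)"
    and y': "y' \<in> S" "\<And>w. w \<in> S \<Longrightarrow> (f w - \<epsilon> * w\<^sup>2) / (p + q * w) \<le> (f y' - \<epsilon> * y'\<^sup>2) / (p + q * y')"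
  shows "y = y'"
proof (rule ccontr)
  assume neq: "y \<noteq> y'"
  define v where "v = (f y - \<epsilon> * y\<^sup>2) / (p + q * y)"
  have v': "v = (f y' - \<epsilon> * y'\<^sup>2) / (p + q * y')"
    unfolding v_def using y(2)[OF y'(1)] y'(2)[OF y(1)] by linarith
  define m where "m = (1 - 1/2) * y + (1/2) * y'"
  have conv: "convex_on S (\<lambda>w. - f w)" using f by (simp add: concave_on_def)
  have m: "m \<in> S" unfolding m_def
    using convexD_alt[OF convex_on_imp_convex[OF conv] y(1) y'(1), of "1/2"] by simp
  have f_m: "f m \<ge> (f y + f y') / 2"
    using convex_onD[OF conv _ _ y(1) y'(1), of "1/2"] by (simp add: m_def field_simps)
  have e1: "f y = v * (p + q * y) + \<epsilon> * y\<^sup>2" using pos[OF y(1)] by (simp add: v_def)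
  have e2: "f y' = v * (p + q * y') + \<epsilon> * y'\<^sup>2" using pos[OF y'(1)] by (simp add: v')
  have "(f m - \<epsilon> * m\<^sup>2) / (p + q * m) \<le> v" using y(2)[OF m] by (simp add: v_def)
  then have "f m - \<epsilon> * m\<^sup>2 \<le> v * (p + q * m)" using pos[OF m] by (simp add: pos_divide_le_eq)
  moreover have "f m - \<epsilon> * m\<^sup>2 - v * (p + q * m) \<ge> \<epsilon> * ((y - y')\<^sup>2 / 4)"
    using f_m unfolding e1 e2 by (simp add: m_def power2_eq_square field_simps)
  moreover have "0 < \<epsilon> * ((y - y')\<^sup>2 / 4)" using \<epsilon> neq by simp
  ultimately show False by linarith
qed

text \<open>The gap \<open>d < e\<close> keeps all denominators positive, so the utilities are
  jointly continuous and the optimality inequalities survive the limit along a convergent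
  subsequence.\<close>

proposition two_player_ratio_equilibrium:
  fixes N\<^sub>1 N\<^sub>2 :: "real \<Rightarrow> real \<Rightarrow> real"
  assumes order: "c \<le> d" "d < e" "e \<le> k"
    and cont\<^sub>1: "continuous_on ({e..k} \<times> {c..d}) (\<lambda>(z, y). N\<^sub>1 y z)"
    and cont\<^sub>2: "continuous_on ({c..d} \<times> {e..k}) (\<lambda>(y, z). N\<^sub>2 z y)"
    and conc\<^sub>1: "\<And>z. z \<in> {e..k} \<Longrightarrow> concave_on {c..d} (\<lambda>y. N\<^sub>1 y z)"
    and conc\<^sub>2: "\<And>y. y \<in> {c..d} \<Longrightarrow> concave_on {e..k} (\<lambda>z. N\<^sub>2 z y)"
  obtains y z where "y \<in> {c..d}" "z \<in> {e..k}"
    "\<And>w. w \<in> {c..d} \<Longrightarrow> N\<^sub>1 w z / (z - w) \<le> N\<^sub>1 y z / (z - y)"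
    "\<And>w. w \<in> {e..k} \<Longrightarrow> N\<^sub>2 w y / (w - y) \<le> N\<^sub>2 z y / (z - y)"
proof -
  let ?U\<^sub>1 = "\<lambda>\<epsilon> y z. (N\<^sub>1 y z - \<epsilon> * y\<^sup>2) / (z - y)"
  let ?U\<^sub>2 = "\<lambda>\<epsilon> z y. (N\<^sub>2 z y - \<epsilon> * z\<^sup>2) / (z - y)"
  have perturbed: "\<exists>y\<in>{c..d}. \<exists>z\<in>{e..k}. (\<forall>w\<in>{c..d}. ?U\<^sub>1 \<epsilon> w z \<le> ?U\<^sub>1 \<epsilon> y z) \<and>
      (\<forall>w\<in>{e..k}. ?U\<^sub>2 \<epsilon> w y \<le> ?U\<^sub>2 \<epsilon> z y)" if \<epsilon>: "0 < \<epsilon>" for \<epsilon>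
  proof -
    obtain \<phi> where \<phi>: "continuous_on {e..k} \<phi>" "\<phi> \<in> {e..k} \<rightarrow> {c..d}"
      "\<And>z w. z \<in> {e..k} \<Longrightarrow> w \<in> {c..d} \<Longrightarrow> ?U\<^sub>1 \<epsilon> w z \<le> ?U\<^sub>1 \<epsilon> (\<phi> z) z"
    proof (rule continuous_argmax[where U="?U\<^sub>1 \<epsilon>" and I="{c..d}" and J="{e..k}"])
      show "continuous_on ({e..k} \<times> {c..d}) (\<lambda>(z, y). ?U\<^sub>1 \<epsilon> y z)"
        using cont\<^sub>1 order unfolding case_prod_beta by (auto intro!: continuous_intros)
      fix z y y' assume *: "z \<in> {e..k}" "y \<in> {c..d}" "y' \<in> {c..d}"
        "\<forall>w\<in>{c..d}. ?U\<^sub>1 \<epsilon> w z \<le> ?U\<^sub>1 \<epsilon> y z" "\<forall>w\<in>{c..d}. ?U\<^sub>1 \<epsilon> w z \<le> ?U\<^sub>1 \<epsilon> y' z"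
      show "y = y'"
        by (rule unique_max_perturbed_ratio[OF conc\<^sub>1[OF *(1)] \<epsilon>, of z "-1"]) (use * order in auto)
    qed (use order in auto)
    obtain \<psi> where \<psi>: "continuous_on {c..d} \<psi>" "\<psi> \<in> {c..d} \<rightarrow> {e..k}"
      "\<And>y w. y \<in> {c..d} \<Longrightarrow> w \<in> {e..k} \<Longrightarrow> ?U\<^sub>2 \<epsilon> w y \<le> ?U\<^sub>2 \<epsilon> (\<psi> y) y"
    proof (rule continuous_argmax[where U="?U\<^sub>2 \<epsilon>" and I="{e..k}" and J="{c..d}"])
      show "continuous_on ({c..d} \<times> {e..k}) (\<lambda>(y, z). ?U\<^sub>2 \<epsilon> z y)"
        using cont\<^sub>2 order unfolding case_prod_beta by (auto intro!: continuous_intros)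
      fix y z z' assume *: "y \<in> {c..d}" "z \<in> {e..k}" "z' \<in> {e..k}"
        "\<forall>w\<in>{e..k}. ?U\<^sub>2 \<epsilon> w y \<le> ?U\<^sub>2 \<epsilon> z y" "\<forall>w\<in>{e..k}. ?U\<^sub>2 \<epsilon> w y \<le> ?U\<^sub>2 \<epsilon> z' y"
      show "z = z'"
        by (rule unique_max_perturbed_ratio[OF conc\<^sub>2[OF *(1)] \<epsilon>, of "- y" 1]) (use * order in auto)
    qed (use order in auto)
    \<comment> \<open>A fixed point of the composed best responses is an equilibrium, so a self-map
      of an interval suffices.\<close>
    have "continuous_on {c..d} (\<lambda>y. \<phi> (\<psi> y))"
      using \<psi>(2) by (intro continuous_on_compose2[OF \<phi>(1) \<psi>(1)]) auto
    then obtain y where y: "y \<in> {c..d}" "\<phi> (\<psi> y) = y"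
      using brouwer[of "{c..d}" "\<lambda>y. \<phi> (\<psi> y)"] \<phi>(2) \<psi>(2) order by (auto simp: Pi_iff)
    have "\<psi> y \<in> {e..k}" using \<psi>(2) y(1) by auto
    then show ?thesis using y \<phi>(3)[of "\<psi> y"] \<psi>(3)[of y] by (intro bexI[of _ y] bexI[of _ "\<psi> y"]) auto
  qed
  define \<epsilon> where "\<epsilon> n = inverse (real (Suc n))" for n
  have "\<epsilon> n > 0" for n by (simp add: \<epsilon>_def)
  with perturbed have "\<exists>y z. y\<in>{c..d} \<and> z\<in>{e..k} \<and> (\<forall>w\<in>{c..d}. ?U\<^sub>1 (\<epsilon> n) w z \<le> ?U\<^sub>1 (\<epsilon> n) y z) \<and>
      (\<forall>w\<in>{e..k}. ?U\<^sub>2 (\<epsilon> n) w y \<le> ?U\<^sub>2 (\<epsilon> n) z y)" for n by blast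
  then obtain Y Z where YZ: "\<And>n. Y n \<in> {c..d}" "\<And>n. Z n \<in> {e..k}"
      "\<And>n w. w \<in> {c..d} \<Longrightarrow> ?U\<^sub>1 (\<epsilon> n) w (Z n) \<le> ?U\<^sub>1 (\<epsilon> n) (Y n) (Z n)"
      "\<And>n w. w \<in> {e..k} \<Longrightarrow> ?U\<^sub>2 (\<epsilon> n) w (Y n) \<le> ?U\<^sub>2 (\<epsilon> n) (Z n) (Y n)" by metis
  have "seq_compact ({c..d} \<times> {e..k})" by (intro compact_imp_seq_compact compact_Times) auto
  moreover have "\<forall>n. (Y n, Z n) \<in> {c..d} \<times> {e..k}" using YZ by blast
  ultimately obtain l r where l: "l \<in> {c..d} \<times> {e..k}" "strict_mono r" "((\<lambda>n. (Y n, Z n)) \<circ> r) \<longlonglongrightarrow> l"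
    by (rule seq_compactE)
  obtain y z where yz: "l = (y, z)" by (cases l)
  have y: "y \<in> {c..d}" and z: "z \<in> {e..k}" using l(1) yz by auto
  have lim: "(\<lambda>n. Y (r n)) \<longlonglongrightarrow> y" "(\<lambda>n. Z (r n)) \<longlonglongrightarrow> z"
    using tendsto_fst[OF l(3)] tendsto_snd[OF l(3)] by (simp_all add: yz o_def)
  have \<epsilon>_lim: "(\<lambda>n. \<epsilon> (r n)) \<longlonglongrightarrow> 0"
    using LIMSEQ_subseq_LIMSEQ[OF LIMSEQ_inverse_real_of_nat l(2)] by (simp add: \<epsilon>_def o_def)
  have zy: "z' - y' \<noteq> 0" if "y' \<in> {c..d}" "z' \<in> {e..k}" for y' z' using that order by auto
  have N1_lim: "(\<lambda>n. N\<^sub>1 (w n) (Z (r n))) \<longlonglongrightarrow> N\<^sub>1 w' z" if "w \<longlonglongrightarrow> w'" "\<And>n. w n \<in> {c..d}" "w' \<in> {c..d}" for w w'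
    using continuous_on_tendsto_compose[OF cont\<^sub>1 tendsto_Pair[OF lim(2) that(1)]] that z YZ(2) by auto
  have N2_lim: "(\<lambda>n. N\<^sub>2 (w n) (Y (r n))) \<longlonglongrightarrow> N\<^sub>2 w' y" if "w \<longlonglongrightarrow> w'" "\<And>n. w n \<in> {e..k}" "w' \<in> {e..k}" for w w'
    using continuous_on_tendsto_compose[OF cont\<^sub>2 tendsto_Pair[OF lim(1) that(1)]] that y YZ(1) by auto
  have U1_lim: "(\<lambda>n. ?U\<^sub>1 (\<epsilon> (r n)) (w n) (Z (r n))) \<longlonglongrightarrow> ?U\<^sub>1 0 w' z" if "w \<longlonglongrightarrow> w'" "\<And>n. w n \<in> {c..d}" "w' \<in> {c..d}" for w w'
    using that zy[OF that(3) z] by (intro tendsto_intros N1_lim \<epsilon>_lim lim) auto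
  have U2_lim: "(\<lambda>n. ?U\<^sub>2 (\<epsilon> (r n)) (w n) (Y (r n))) \<longlonglongrightarrow> ?U\<^sub>2 0 w' y" if "w \<longlonglongrightarrow> w'" "\<And>n. w n \<in> {e..k}" "w' \<in> {e..k}" for w w'
    using that zy[OF y that(3)] by (intro tendsto_intros N2_lim \<epsilon>_lim lim) auto
  show thesis
  proof (rule that[OF y z])
    fix w assume w: "w \<in> {c..d}"
    have "?U\<^sub>1 0 w z \<le> ?U\<^sub>1 0 y z"
      by (rule LIMSEQ_le[OF U1_lim[OF tendsto_const w w] U1_lim[OF lim(1) YZ(1) y]]) (use YZ(3) w in blast)
    then show "N\<^sub>1 w z / (z - w) \<le> N\<^sub>1 y z / (z - y)" by simp
  next
    fix w assume w: "w \<in> {e..k}"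
    have "?U\<^sub>2 0 w y \<le> ?U\<^sub>2 0 z y"
      by (rule LIMSEQ_le[OF U2_lim[OF tendsto_const w w] U2_lim[OF lim(2) YZ(2) z]]) (use YZ(4) w in blast)
    then show "N\<^sub>2 w y / (w - y) \<le> N\<^sub>2 z y / (z - y)" by simp
  qed
qed

section \<open>Equilibria of the Dynkin game\<close>

lemma ereal_eq_SUP_iff:
  assumes "s \<in> S"
  shows "ereal (u s) = (SUP t\<in>S. ereal (u t)) \<longleftrightarrow> (\<forall>t\<in>S. u t \<le> u s)"
proof
  assume eq: "ereal (u s) = (SUP t\<in>S. ereal (u t))"
  show "\<forall>t\<in>S. u t \<le> u s"
  proof
    fix t assume "t \<in> S"
    then have "ereal (u t) \<le> ereal (u s)" unfolding eq by (rule SUP_upper)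
    then show "u t \<le> u s" by simp
  qed
next
  assume "\<forall>t\<in>S. u t \<le> u s"
  then show "ereal (u s) = (SUP t\<in>S. ereal (u t))"
    using assms by (intro antisym SUP_upper SUP_least) auto
qed

lemma concave_on_diff_affine:
  fixes f :: "real \<Rightarrow> real"
  assumes "concave_on S f"
  shows "concave_on S (\<lambda>y. f y - (p + q * y))"
proof -
  have f: "convex_on S (\<lambda>y. - f y)" using assms by (simp add: concave_on_def)
  have "convex_on S (\<lambda>y. p + q * y)"
    using convex_on_imp_convex[OF f] by (intro convex_onI) (auto simp: algebra_simps)
  from convex_on_add[OF f this] show ?thesis by (simp add: concave_on_def)
qed

section \<open>Closed forms of the hitting rewards\<close>

context brownian_motion_family
begin

text \<open>The hitting reward is the payoff of a player who never stops in a game with all three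
  rewards equal to \<open>g\<close>, so its explicit form comes from the payoff formulas.\<close>

lemma hitting_reward_eq_payoff:
  assumes "closed A"
  shows "hitting_reward P W g A x = payoff P W g g g x (hitting_time W {}) (hitting_time W A)"
  unfolding hitting_reward_def payoff_def expect_def
proof (rule Bochner_Integration.integral_cong[OF refl])
  fix \<omega> assume "\<omega> \<in> space (completion (P x))"
  then have "\<omega> \<in> space M" by (simp add: space_P)
  then have "hitting_time W A \<omega> \<le> hitting_time W {} \<omega>"
    using hitting_time_antimono[of W \<omega>, OF continuous_paths _ assms] by simp
  then show "ext_cemetery g (killed W (hitting_time W A \<omega>) \<omega>) =
    (if hitting_time W {} \<omega> < hitting_time W A \<omega> then ext_cemetery g (killed W (hitting_time W {} \<omega>) \<omega>)
     else if hitting_time W A \<omega> < hitting_time W {} \<omega> then ext_cemetery g (killed W (hitting_time W A \<omega>) \<omega>)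
     else ext_cemetery g (killed W (hitting_time W {} \<omega>) \<omega>))"
    by (auto simp: le_less)
qed

text \<open>An end outside \<open>A\<close> must be 0 or 1, where \<open>f\<close> and
  \<open>g\<close> both vanish; so the values of \<open>g\<close> at both ends determine the
  payoff.\<close>

lemma payoff_never_stop:
  assumes adm: "admissible_rewards f g h" and A: "closed A"
    and x: "0 \<le> \<alpha>" "\<alpha> \<le> x" "x \<le> \<beta>" "\<beta> \<le> 1"
    and ends: "\<alpha> \<in> absorbing A" "\<beta> \<in> absorbing A" "absorbing A \<inter> {\<alpha><..<\<beta>} = {}"
    and reward: "p + q * \<alpha> = g \<alpha>" "p + q * \<beta> = g \<beta>"
  shows "payoff P W f g h x (hitting_time W {}) (hitting_time W A) = p + q * x"
proof (rule payoff_hitting_times[OF adm A closed_empty _ x])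
  have "f e = g e" if "e \<in> {\<alpha>, \<beta>}" "e \<notin> A" for e
  proof -
    have "e = 0 \<or> e = 1" using that ends x unfolding absorbing_def by auto
    then show ?thesis using admissible_rewardsD(4-7)[OF adm] by auto
  qed
  then show "p + q * \<alpha> = (if \<alpha> \<in> A then g \<alpha> else f \<alpha>)" "p + q * \<beta> = (if \<beta> \<in> A then g \<beta> else f \<beta>)"
    using reward by auto
qed (use ends in auto)

lemma payoff_never_stop_right:
  assumes "admissible_rewards f g h" "0 < z" "z \<le> 1" "0 \<le> x" "x \<le> z"
  shows "payoff P W f g h x (hitting_time W {}) (hitting_time W {z..1}) = g z / z * x"
proof -
  have "payoff P W f g h x (hitting_time W {}) (hitting_time W {z..1}) = 0 + g z / z * x"
    by (rule payoff_never_stop[OF assms(1), where \<alpha>=0 and \<beta>=z])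
      (use assms admissible_rewardsD(6)[OF assms(1)] in \<open>auto simp: absorbing_def\<close>)
  then show ?thesis by simp
qed

lemma payoff_never_stop_left:
  assumes "admissible_rewards f g h" "0 \<le> y" "y < 1" "y \<le> x" "x \<le> 1"
  shows "payoff P W f g h x (hitting_time W {}) (hitting_time W {0..y}) = g y / (1 - y) * (1 - x)"
proof -
  define j where "j = g y / (1 - y)"
  have "payoff P W f g h x (hitting_time W {}) (hitting_time W {0..y}) = j + (- j) * x"
  proof (rule payoff_never_stop[OF assms(1), where \<alpha>=y and \<beta>=1])
    have "j * (1 - y) = g y" using assms(3) by (simp add: j_def)
    then show "j + (- j) * y = g y" by (simp add: algebra_simps)
  qed (use assms admissible_rewardsD(7)[OF assms(1)] in \<open>auto simp: absorbing_def\<close>)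
  then show ?thesis unfolding j_def[symmetric] by (simp add: algebra_simps)
qed

lemma admissible_rewards_diag: "admissible_rewards f g h \<Longrightarrow> admissible_rewards g g g"
  unfolding admissible_rewards_def by auto

lemma hitting_reward_right:
  assumes "admissible_rewards f g h" "0 < z" "z \<le> 1" "0 \<le> x" "x \<le> z"
  shows "hitting_reward P W g {z..1} x = g z / z * x"
  using payoff_never_stop_right[OF admissible_rewards_diag[OF assms(1)] assms(2-)]
  by (simp add: hitting_reward_eq_payoff)

lemma hitting_reward_left:
  assumes "admissible_rewards f g h" "0 \<le> y" "y < 1" "y \<le> x" "x \<le> 1"
  shows "hitting_reward P W g {0..y} x = g y / (1 - y) * (1 - x)"
  using payoff_never_stop_left[OF admissible_rewards_diag[OF assms(1)] assms(2-)]
  by (simp add: hitting_reward_eq_payoff)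

lemma best_response_iff:
  assumes "\<tau> \<in> stopping_times M G P"
  shows "ereal (payoff P W f g h x \<tau> \<sigma>) = (SUP \<tau>' \<in> stopping_times M G P. ereal (payoff P W f g h x \<tau>' \<sigma>)) \<longleftrightarrow>
    (\<forall>\<tau>'\<in>stopping_times M G P. payoff P W f g h x \<tau>' \<sigma> \<le> payoff P W f g h x \<tau> \<sigma>)"
  by (rule ereal_eq_SUP_iff[OF assms, of "\<lambda>\<tau>'. payoff P W f g h x \<tau>' \<sigma>"])

section \<open>Best responses to interval stopping regions\<close>

context
  fixes f g h :: "real \<Rightarrow> real"
  assumes adm: "admissible_rewards f g h"
begin

text \<open>The opponent stops at time 0, so the component of \<open>x\<close> degenerates to a
  point: no strategy earns more than \<open>g x\<close>, and any disjoint region earns it.\<close>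

lemma payoff_start_in_opponent_region:
  assumes AB: "closed A" "closed B" "A \<inter> B = {}" and x: "x \<in> {0<..<1}" "x \<in> A"
    and \<tau>: "\<tau> \<in> stopping_times M G P"
  shows "payoff P W f g h x \<tau> (hitting_time W A) \<le> payoff P W f g h x (hitting_time W B) (hitting_time W A)"
proof -
  have "payoff P W f g h x \<tau> (hitting_time W A) \<le> g x + 0 * x"
    by (rule payoff_le[OF adm AB(1) \<tau>, where \<alpha>=x and \<beta>=x]) (use x in \<open>auto simp: absorbing_def\<close>)
  also have "\<dots> = payoff P W f g h x (hitting_time W B) (hitting_time W A)"
    by (rule payoff_hitting_times[OF adm AB, where \<alpha>=x and \<beta>=x, symmetric])
      (use x in \<open>auto simp: absorbing_def\<close>)
  finally show ?thesis .
qed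

text \<open>With waiting slope \<open>g r / r\<close>, the affine majorant bounds every payoff from
  \<open>x\<close>. It touches the rewards at the end points reached from \<open>x\<close>: 0 and
  \<open>l\<^sub>1\<close>, or \<open>x\<close> itself, or \<open>l\<^sub>2\<close> and
  \<open>r\<close>.\<close>

lemma first_player_best_response:
  assumes order: "0 < a\<^sub>1" "a\<^sub>1 \<le> l\<^sub>1" "l\<^sub>1 \<le> l\<^sub>2" "l\<^sub>2 \<le> a\<^sub>2" "a\<^sub>2 < r" "r \<le> 1"
    and f: "convex_on {0..a\<^sub>1} f" "concave_on {a\<^sub>1..a\<^sub>2} f" "convex_on {a\<^sub>2..1} f"
    and opt\<^sub>1: "\<And>w. w \<in> {a\<^sub>1..l\<^sub>2} \<Longrightarrow> f w / w \<le> f l\<^sub>1 / l\<^sub>1"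
    and opt\<^sub>2: "\<And>w. w \<in> {l\<^sub>1..a\<^sub>2} \<Longrightarrow>
      (f w - g r / r * w) / (r - w) \<le> (f l\<^sub>2 - g r / r * l\<^sub>2) / (r - l\<^sub>2)"
    and nonneg: "g r / r * l\<^sub>2 \<le> f l\<^sub>2"
    and x: "x \<in> {0<..<1}" and \<tau>: "\<tau> \<in> stopping_times M G P"
  shows "payoff P W f g h x \<tau> (hitting_time W {r..1}) \<le>
    payoff P W f g h x (hitting_time W {l\<^sub>1..l\<^sub>2}) (hitting_time W {r..1})"
proof (cases "r \<le> x")
  case True
  then show ?thesis using x order by (intro payoff_start_in_opponent_region \<tau>) auto
next
  case False
  have fr: "f r \<le> g r / r * r"
    using admissible_rewardsD(10,11)[OF adm, of r] order by auto
  have f': "convex_on {a\<^sub>2..r} f" using f(3) order by (auto intro: convex_on_subset)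
  obtain p q where pq: "\<And>w. w \<in> {0..r} \<Longrightarrow> f w \<le> p + q * w" "0 \<le> p" "g r / r * r \<le> p + q * r"
    and v1: "x \<le> l\<^sub>1 \<Longrightarrow> p = 0 \<and> p + q * l\<^sub>1 = f l\<^sub>1"
    and v2: "l\<^sub>1 < x \<Longrightarrow> x < l\<^sub>2 \<Longrightarrow> p + q * x = f x"
    and v3: "l\<^sub>1 < x \<Longrightarrow> l\<^sub>2 \<le> x \<Longrightarrow> p + q * l\<^sub>2 = f l\<^sub>2 \<and> p + q * r = g r / r * r"
    by (rule concave_majorant_two_boundaries[OF order(1-5) f(1,2) f' admissible_rewardsD(4)[OF adm] fr opt\<^sub>1 opt\<^sub>2 nonneg, of x])
      (use x False in auto)
  have closed: "closed {r..1}" "closed {l\<^sub>1..l\<^sub>2}" "{r..1} \<inter> {l\<^sub>1..l\<^sub>2} = {}" using order by auto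
  have "payoff P W f g h x \<tau> (hitting_time W {r..1}) \<le> p + q * x"
    by (rule payoff_le[OF adm closed(1) \<tau>, where \<alpha>=0 and \<beta>=r])
      (use x False order pq admissible_rewardsD(6)[OF adm] in \<open>auto simp: absorbing_def\<close>)
  also have "\<dots> = payoff P W f g h x (hitting_time W {l\<^sub>1..l\<^sub>2}) (hitting_time W {r..1})"
  proof -
    consider "x \<le> l\<^sub>1" | "l\<^sub>1 < x" "x < l\<^sub>2" | "l\<^sub>1 < x" "l\<^sub>2 \<le> x" by linarith
    then show ?thesis
    proof cases
      case 1
      show ?thesis
        by (rule payoff_hitting_times[OF adm closed, where \<alpha>=0 and \<beta>=l\<^sub>1, symmetric])
          (use x 1 v1 order admissible_rewardsD(4)[OF adm] in \<open>auto simp: absorbing_def\<close>)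
    next
      case 2
      show ?thesis
        by (rule payoff_hitting_times[OF adm closed, where \<alpha>=x and \<beta>=x, symmetric])
          (use x 2 v2 order in \<open>auto simp: absorbing_def\<close>)
    next
      case 3
      show ?thesis
        by (rule payoff_hitting_times[OF adm closed, where \<alpha>=l\<^sub>2 and \<beta>=r, symmetric])
          (use x 3 v3 order False in \<open>auto simp: absorbing_def\<close>)
    qed
  qed
  finally show ?thesis .
qed

text \<open>Left of the opponent's region \<open>f\<close> is convex, so the line from the origin to
  \<open>(l\<^sub>1, g l\<^sub>1)\<close> dominates it and waiting is best. Right of the region the
  majorant with one boundary applies, with \<open>g l\<^sub>2 / (1 - l\<^sub>2)\<close> as
  \<open>j\<close>.\<close>

lemma second_player_best_response:
  assumes order: "0 < l\<^sub>1" "l\<^sub>1 \<le> l\<^sub>2" "l\<^sub>2 < b" "b \<le> r" "r \<le> 1"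
    and f: "convex_on {0..b} f" "concave_on {b..1} f"
    and opt: "\<And>w. w \<in> {b..1} \<Longrightarrow> (f w - g l\<^sub>2 / (1 - l\<^sub>2) * (1 - w)) / (w - l\<^sub>2) \<le>
      (f r - g l\<^sub>2 / (1 - l\<^sub>2) * (1 - r)) / (r - l\<^sub>2)"
    and x: "x \<in> {0<..<1}" and \<tau>: "\<tau> \<in> stopping_times M G P"
  shows "payoff P W f g h x \<tau> (hitting_time W {l\<^sub>1..l\<^sub>2}) \<le>
    payoff P W f g h x (hitting_time W {r..1}) (hitting_time W {l\<^sub>1..l\<^sub>2})"
proof -
  have closed: "closed {l\<^sub>1..l\<^sub>2}" "closed {r..1}" "{l\<^sub>1..l\<^sub>2} \<inter> {r..1} = {}" using order by auto
  have fg: "f l \<le> g l" if "l \<in> {0..1}" for l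
    using admissible_rewardsD(10,11)[OF adm that] by linarith
  consider "x \<in> {l\<^sub>1..l\<^sub>2}" | "x < l\<^sub>1" | "l\<^sub>2 < x" by force
  then show ?thesis
  proof cases
    case 1
    then show ?thesis using x by (intro payoff_start_in_opponent_region[OF closed] \<tau>)
  next
    case 2
    define q where "q = g l\<^sub>1 / l\<^sub>1"
    have q: "q * l\<^sub>1 = g l\<^sub>1" using order by (simp add: q_def)
    have "convex_on {0..l\<^sub>1} f" using f(1) order by (auto intro: convex_on_subset)
    then have le: "f w \<le> 0 + q * w" if "w \<in> {0..l\<^sub>1}" for w
      by (rule convex_on_le_affine) (use that fg[of l\<^sub>1] q order admissible_rewardsD(4)[OF adm] in auto)
    have "payoff P W f g h x \<tau> (hitting_time W {l\<^sub>1..l\<^sub>2}) \<le> 0 + q * x"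
      by (rule payoff_le[OF adm closed(1) \<tau>, where \<alpha>=0 and \<beta>=l\<^sub>1])
        (use x 2 order le q admissible_rewardsD(6)[OF adm] in \<open>auto simp: absorbing_def\<close>)
    also have "\<dots> = payoff P W f g h x (hitting_time W {r..1}) (hitting_time W {l\<^sub>1..l\<^sub>2})"
      by (rule payoff_hitting_times[OF adm closed, where \<alpha>=0 and \<beta>=l\<^sub>1, symmetric])
        (use x 2 order q admissible_rewardsD(4)[OF adm] in \<open>auto simp: absorbing_def\<close>)
    finally show ?thesis .
  next
    case 3
    have j: "g l\<^sub>2 / (1 - l\<^sub>2) * (1 - l\<^sub>2) = g l\<^sub>2" using order by simp
    have f': "convex_on {l\<^sub>2..b} f" using f(1) order by (auto intro: convex_on_subset)
    have fl2: "f l\<^sub>2 \<le> g l\<^sub>2 / (1 - l\<^sub>2) * (1 - l\<^sub>2)" unfolding j using fg[of l\<^sub>2] order by simp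
    obtain p q where pq: "\<And>w. w \<in> {l\<^sub>2..1} \<Longrightarrow> f w \<le> p + q * w"
        "g l\<^sub>2 / (1 - l\<^sub>2) * (1 - l\<^sub>2) \<le> p + q * l\<^sub>2" "0 \<le> p + q * 1"
      and v1: "x \<le> r \<Longrightarrow> p + q * l\<^sub>2 = g l\<^sub>2 / (1 - l\<^sub>2) * (1 - l\<^sub>2) \<and> p + q * r = f r"
      and v2: "r < x \<Longrightarrow> p + q * x = f x"
      by (rule concave_majorant_one_boundary[OF order(3-5) f' f(2) fl2 admissible_rewardsD(5)[OF adm] opt, of x])
        (use x 3 in auto)
    have "payoff P W f g h x \<tau> (hitting_time W {l\<^sub>1..l\<^sub>2}) \<le> p + q * x"
      by (rule payoff_le[OF adm closed(1) \<tau>, where \<alpha>=l\<^sub>2 and \<beta>=1])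
        (use x 3 order pq[unfolded j] admissible_rewardsD(7)[OF adm] in \<open>auto simp: absorbing_def\<close>)
    also have "\<dots> = payoff P W f g h x (hitting_time W {r..1}) (hitting_time W {l\<^sub>1..l\<^sub>2})"
    proof (cases "x \<le> r")
      case True
      show ?thesis
        by (rule payoff_hitting_times[OF adm closed, where \<alpha>=l\<^sub>2 and \<beta>=r, symmetric])
          (use x 3 order True v1[unfolded j] in \<open>auto simp: absorbing_def\<close>)
    next
      case False
      show ?thesis
        by (rule payoff_hitting_times[OF adm closed, where \<alpha>=x and \<beta>=x, symmetric])
          (use x 3 order False v2 in \<open>auto simp: absorbing_def\<close>)
    qed
    finally show ?thesis .
  qed
qed

end

section \<open>The three-player game and its link to Nash equilibria\<close>

context
  fixes f\<^sub>1 g\<^sub>1 h\<^sub>1 f\<^sub>2 g\<^sub>2 h\<^sub>2 :: "real \<Rightarrow> real" and a\<^sub>1 a\<^sub>2 b :: real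
  assumes adm\<^sub>1: "admissible_rewards f\<^sub>1 g\<^sub>1 h\<^sub>1" and adm\<^sub>2: "admissible_rewards f\<^sub>2 g\<^sub>2 h\<^sub>2"
    and order: "0 < a\<^sub>1" "a\<^sub>1 \<le> a\<^sub>2" "a\<^sub>2 < b" "b < 1"
begin

text \<open>Since \<open>a\<^sub>2 < b\<close>, feasible points satisfy \<open>y < z\<close> and the
  value minus infinity never occurs. The first utility separates into a term in \<open>x\<close> and
  a term in \<open>z\<close>.\<close>

lemma utility_eq:
  assumes "s \<in> strategies a\<^sub>1 a\<^sub>2 b"
  shows "utility P W f\<^sub>1 g\<^sub>1 f\<^sub>2 g\<^sub>2 1 s = ereal (f\<^sub>1 (s $ 1) / s $ 1 - g\<^sub>1 (s $ 3) / s $ 3)"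
    and "utility P W f\<^sub>1 g\<^sub>1 f\<^sub>2 g\<^sub>2 2 s =
      ereal ((f\<^sub>1 (s $ 2) - g\<^sub>1 (s $ 3) / s $ 3 * s $ 2) / (s $ 3 - s $ 2))"
    and "utility P W f\<^sub>1 g\<^sub>1 f\<^sub>2 g\<^sub>2 3 s =
      ereal ((f\<^sub>2 (s $ 3) - g\<^sub>2 (s $ 2) / (1 - s $ 2) * (1 - s $ 3)) / (s $ 3 - s $ 2))"
  using assms order hitting_reward_right[OF adm\<^sub>1, of "s $ 3" "s $ 1"]
    hitting_reward_right[OF adm\<^sub>1, of "s $ 3" "s $ 2"] hitting_reward_left[OF adm\<^sub>2, of "s $ 2" "s $ 3"]
  by (auto simp: utility_def strategies_def Let_def diff_divide_distrib)

text \<open>Each supremum becomes a family of real inequalities over the deviations feasible for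
  that player. In the first family the term in \<open>z\<close> cancels.\<close>

lemma generalised_equilibrium_iff:
  "generalised_equilibrium (strategies a\<^sub>1 a\<^sub>2 b) (utility P W f\<^sub>1 g\<^sub>1 f\<^sub>2 g\<^sub>2) s \<longleftrightarrow>
    s \<in> strategies a\<^sub>1 a\<^sub>2 b \<and>
    (\<forall>w\<in>{a\<^sub>1..s $ 2}. f\<^sub>1 w / w \<le> f\<^sub>1 (s $ 1) / s $ 1) \<and>
    (\<forall>w\<in>{s $ 1..a\<^sub>2}. (f\<^sub>1 w - g\<^sub>1 (s $ 3) / s $ 3 * w) / (s $ 3 - w) \<le>
      (f\<^sub>1 (s $ 2) - g\<^sub>1 (s $ 3) / s $ 3 * s $ 2) / (s $ 3 - s $ 2)) \<and>
    (\<forall>w\<in>{b..1}. (f\<^sub>2 w - g\<^sub>2 (s $ 2) / (1 - s $ 2) * (1 - w)) / (w - s $ 2) \<le>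
      (f\<^sub>2 (s $ 3) - g\<^sub>2 (s $ 2) / (1 - s $ 2) * (1 - s $ 3)) / (s $ 3 - s $ 2))"
proof (cases "s \<in> strategies a\<^sub>1 a\<^sub>2 b")
  case True
  let ?C = "strategies a\<^sub>1 a\<^sub>2 b" and ?U = "utility P W f\<^sub>1 g\<^sub>1 f\<^sub>2 g\<^sub>2"
  have self: "replace s i (s $ i) = s" for i by (simp add: replace_def vec_eq_iff)
  have comp: "replace s i w $ j = (if j = i then w else s $ j)" for i j w by (simp add: replace_def)
  have feas: "{w. replace s 1 w \<in> ?C} = {a\<^sub>1..s $ 2}" "{w. replace s 2 w \<in> ?C} = {s $ 1..a\<^sub>2}"
    "{w. replace s 3 w \<in> ?C} = {b..1}"
    using True by (auto simp: strategies_def comp)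
  have mem: "s $ 1 \<in> {a\<^sub>1..s $ 2}" "s $ 2 \<in> {s $ 1..a\<^sub>2}" "s $ 3 \<in> {b..1}"
    using True by (auto simp: strategies_def)
  let ?u\<^sub>1 = "\<lambda>w. f\<^sub>1 w / w - g\<^sub>1 (s $ 3) / s $ 3"
    and ?u\<^sub>2 = "\<lambda>w. (f\<^sub>1 w - g\<^sub>1 (s $ 3) / s $ 3 * w) / (s $ 3 - w)"
    and ?u\<^sub>3 = "\<lambda>w. (f\<^sub>2 w - g\<^sub>2 (s $ 2) / (1 - s $ 2) * (1 - w)) / (w - s $ 2)"
  have U1: "?U 1 (replace s 1 w) = ereal (?u\<^sub>1 w)" if "w \<in> {a\<^sub>1..s $ 2}" for w
  proof -
    have "replace s 1 w \<in> ?C" using that feas(1) by blast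
    from utility_eq(1)[OF this] show ?thesis by (simp add: comp)
  qed
  have U2: "?U 2 (replace s 2 w) = ereal (?u\<^sub>2 w)" if "w \<in> {s $ 1..a\<^sub>2}" for w
  proof -
    have "replace s 2 w \<in> ?C" using that feas(2) by blast
    from utility_eq(2)[OF this] show ?thesis by (simp add: comp)
  qed
  have U3: "?U 3 (replace s 3 w) = ereal (?u\<^sub>3 w)" if "w \<in> {b..1}" for w
  proof -
    have "replace s 3 w \<in> ?C" using that feas(3) by blast
    from utility_eq(3)[OF this] show ?thesis by (simp add: comp)
  qed
  have e1: "?U 1 s = (SUP w\<in>{w. replace s 1 w \<in> ?C}. ?U 1 (replace s 1 w)) \<longleftrightarrow>
      (\<forall>w\<in>{a\<^sub>1..s $ 2}. ?u\<^sub>1 w \<le> ?u\<^sub>1 (s $ 1))"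
    unfolding feas using U1[OF mem(1)] ereal_eq_SUP_iff[OF mem(1), of ?u\<^sub>1] U1 by (simp add: self)
  have e2: "?U 2 s = (SUP w\<in>{w. replace s 2 w \<in> ?C}. ?U 2 (replace s 2 w)) \<longleftrightarrow>
      (\<forall>w\<in>{s $ 1..a\<^sub>2}. ?u\<^sub>2 w \<le> ?u\<^sub>2 (s $ 2))"
    unfolding feas using U2[OF mem(2)] ereal_eq_SUP_iff[OF mem(2), of ?u\<^sub>2] U2 by (simp add: self)
  have e3: "?U 3 s = (SUP w\<in>{w. replace s 3 w \<in> ?C}. ?U 3 (replace s 3 w)) \<longleftrightarrow>
      (\<forall>w\<in>{b..1}. ?u\<^sub>3 w \<le> ?u\<^sub>3 (s $ 3))"
    unfolding feas using U3[OF mem(3)] ereal_eq_SUP_iff[OF mem(3), of ?u\<^sub>3] U3 by (simp add: self)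
  show ?thesis
    unfolding generalised_equilibrium_def forall_3 e1 e2 e3 using True by simp
qed (simp add: generalised_equilibrium_def)

lemma generalised_equilibrium_exists:
  assumes "concave_on {a\<^sub>1..a\<^sub>2} f\<^sub>1" "concave_on {b..1} f\<^sub>2"
  shows "\<exists>s. generalised_equilibrium (strategies a\<^sub>1 a\<^sub>2 b) (utility P W f\<^sub>1 g\<^sub>1 f\<^sub>2 g\<^sub>2) s"
proof -
  note cont\<^sub>1 = admissible_rewardsD(1,2)[OF adm\<^sub>1] and cont\<^sub>2 = admissible_rewardsD(1,2)[OF adm\<^sub>2]
  \<comment> \<open>The maximum is taken over the whole interval, before \<open>y\<close> is known;
    its maximiser \<open>x\<close> then fixes \<open>{x..a\<^sub>2}\<close> as the range of the
    second player.\<close>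
  have "continuous_on {a\<^sub>1..a\<^sub>2} (\<lambda>w. f\<^sub>1 w / w)"
    using order by (intro continuous_intros continuous_on_subset[OF cont\<^sub>1(1)]) auto
  then obtain x where x: "x \<in> {a\<^sub>1..a\<^sub>2}" "\<And>w. w \<in> {a\<^sub>1..a\<^sub>2} \<Longrightarrow> f\<^sub>1 w / w \<le> f\<^sub>1 x / x"
    using continuous_attains_sup[of "{a\<^sub>1..a\<^sub>2}" "\<lambda>w. f\<^sub>1 w / w"] order by fastforce
  obtain y z where yz: "y \<in> {x..a\<^sub>2}" "z \<in> {b..1}"
    "\<And>w. w \<in> {x..a\<^sub>2} \<Longrightarrow> (f\<^sub>1 w - g\<^sub>1 z / z * w) / (z - w) \<le> (f\<^sub>1 y - g\<^sub>1 z / z * y) / (z - y)"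
    "\<And>w. w \<in> {b..1} \<Longrightarrow> (f\<^sub>2 w - g\<^sub>2 y / (1 - y) * (1 - w)) / (w - y) \<le>
      (f\<^sub>2 z - g\<^sub>2 y / (1 - y) * (1 - z)) / (z - y)"
  proof (rule two_player_ratio_equilibrium[of x a\<^sub>2 b 1 "\<lambda>y z. f\<^sub>1 y - g\<^sub>1 z / z * y"
        "\<lambda>z y. f\<^sub>2 z - g\<^sub>2 y / (1 - y) * (1 - z)"])
    have fst_snd: "continuous_on (S \<times> T) (\<lambda>p. \<phi> (fst p))" "continuous_on (T \<times> S) (\<lambda>p. \<phi> (snd p))"
      if "continuous_on {0..1} \<phi>" "S \<subseteq> {0..1}" for \<phi> :: "real \<Rightarrow> real" and S T :: "real set"
      by (rule continuous_on_compose2[OF that(1)]; use that(2) in \<open>auto intro!: continuous_intros\<close>)+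
    have sub: "{x..a\<^sub>2} \<subseteq> {0..1}" "{b..1} \<subseteq> {0..1}" using order x(1) by auto
    show "continuous_on ({b..1} \<times> {x..a\<^sub>2}) (\<lambda>(z, y). f\<^sub>1 y - g\<^sub>1 z / z * y)"
      unfolding case_prod_beta
      by (intro continuous_intros fst_snd(1)[OF cont\<^sub>1(2) sub(2)] fst_snd(2)[OF cont\<^sub>1(1) sub(1)])
        (use order in auto)
    show "continuous_on ({x..a\<^sub>2} \<times> {b..1}) (\<lambda>(y, z). f\<^sub>2 z - g\<^sub>2 y / (1 - y) * (1 - z))"
      unfolding case_prod_beta
      by (intro continuous_intros fst_snd(2)[OF cont\<^sub>2(1) sub(2)] fst_snd(1)[OF cont\<^sub>2(2) sub(1)])
        (use order in auto)
    have "concave_on {x..a\<^sub>2} f\<^sub>1"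
      using assms(1) x(1) unfolding concave_on_def by (auto intro: convex_on_subset)
    then show "concave_on {x..a\<^sub>2} (\<lambda>y. f\<^sub>1 y - g\<^sub>1 z / z * y)" for z
      using concave_on_diff_affine[of "{x..a\<^sub>2}" f\<^sub>1 0 "g\<^sub>1 z / z"] by simp
    show "concave_on {b..1} (\<lambda>z. f\<^sub>2 z - g\<^sub>2 y / (1 - y) * (1 - z))" for y
      using concave_on_diff_affine[OF assms(2), of "g\<^sub>2 y / (1 - y)" "- (g\<^sub>2 y / (1 - y))"]
      by (simp add: right_diff_distrib)
  qed (use order x in auto)
  define s :: "real ^ 3" where "s = vector [x, y, z]"
  have s_comp: "s $ 1 = x" "s $ 2 = y" "s $ 3 = z" by (simp_all add: s_def)
  have "s \<in> strategies a\<^sub>1 a\<^sub>2 b" using x(1) yz(1,2) by (simp add: s_comp strategies_def)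
  moreover have "f\<^sub>1 w / w \<le> f\<^sub>1 x / x" if "w \<in> {a\<^sub>1..y}" for w using that yz(1) by (intro x(2)) auto
  ultimately have "generalised_equilibrium (strategies a\<^sub>1 a\<^sub>2 b) (utility P W f\<^sub>1 g\<^sub>1 f\<^sub>2 g\<^sub>2) s"
    unfolding generalised_equilibrium_iff s_comp using yz(3,4) by blast
  then show ?thesis ..
qed

text \<open>The denominator of the second utility is positive, so its sign is that of the gain of
  stopping over waiting at \<open>l\<^sub>2\<close>. A nonnegative gain supplies the hypothesis
  \<open>nonneg\<close> of the first player's best response; the second player's holds in any
  case.\<close>

lemma nash_iff_utility_nonneg:
  assumes f\<^sub>1: "convex_on {0..a\<^sub>1} f\<^sub>1" "concave_on {a\<^sub>1..a\<^sub>2} f\<^sub>1" "convex_on {a\<^sub>2..1} f\<^sub>1"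
    and f\<^sub>2: "convex_on {0..b} f\<^sub>2" "concave_on {b..1} f\<^sub>2"
    and eq: "generalised_equilibrium (strategies a\<^sub>1 a\<^sub>2 b) (utility P W f\<^sub>1 g\<^sub>1 f\<^sub>2 g\<^sub>2) s"
  shows "utility P W f\<^sub>1 g\<^sub>1 f\<^sub>2 g\<^sub>2 2 s \<ge> 0 \<longleftrightarrow>
    nash_equilibrium M G P W f\<^sub>1 g\<^sub>1 h\<^sub>1 f\<^sub>2 g\<^sub>2 h\<^sub>2
      (hitting_time W {s $ 1..s $ 2}, hitting_time W {s $ 3..1})"
proof -
  define l\<^sub>1 l\<^sub>2 r where lr: "l\<^sub>1 = s $ 1" "l\<^sub>2 = s $ 2" "r = s $ 3"
  have s: "s \<in> strategies a\<^sub>1 a\<^sub>2 b"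
    and opt\<^sub>1: "\<And>w. w \<in> {a\<^sub>1..l\<^sub>2} \<Longrightarrow> f\<^sub>1 w / w \<le> f\<^sub>1 l\<^sub>1 / l\<^sub>1"
    and opt\<^sub>2: "\<And>w. w \<in> {l\<^sub>1..a\<^sub>2} \<Longrightarrow>
      (f\<^sub>1 w - g\<^sub>1 r / r * w) / (r - w) \<le> (f\<^sub>1 l\<^sub>2 - g\<^sub>1 r / r * l\<^sub>2) / (r - l\<^sub>2)"
    and opt\<^sub>3: "\<And>w. w \<in> {b..1} \<Longrightarrow> (f\<^sub>2 w - g\<^sub>2 l\<^sub>2 / (1 - l\<^sub>2) * (1 - w)) / (w - l\<^sub>2) \<le>
      (f\<^sub>2 r - g\<^sub>2 l\<^sub>2 / (1 - l\<^sub>2) * (1 - r)) / (r - l\<^sub>2)"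
    using eq unfolding generalised_equilibrium_iff lr by blast+
  have lr_order: "a\<^sub>1 \<le> l\<^sub>1" "l\<^sub>1 \<le> l\<^sub>2" "l\<^sub>2 \<le> a\<^sub>2" "b \<le> r" "r \<le> 1"
    using s by (auto simp: strategies_def lr)
  have more_order: "0 < l\<^sub>1" "l\<^sub>2 < b" "a\<^sub>2 < r" "0 < l\<^sub>2" "l\<^sub>2 < 1" "0 < r" "l\<^sub>2 < r" using lr_order order by auto
  have stop: "hitting_time W {l\<^sub>1..l\<^sub>2} \<in> stopping_times M G P" "hitting_time W {r..1} \<in> stopping_times M G P"
    "hitting_time W {} \<in> stopping_times M G P"
    by (intro hitting_time_stopping_time closed_atLeastAtMost closed_empty)+
  define best where "best \<longleftrightarrow> (\<forall>x\<in>{0<..<1}.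
      (\<forall>\<tau>\<in>stopping_times M G P. payoff P W f\<^sub>1 g\<^sub>1 h\<^sub>1 x \<tau> (hitting_time W {r..1}) \<le>
        payoff P W f\<^sub>1 g\<^sub>1 h\<^sub>1 x (hitting_time W {l\<^sub>1..l\<^sub>2}) (hitting_time W {r..1})) \<and>
      (\<forall>\<tau>\<in>stopping_times M G P. payoff P W f\<^sub>2 g\<^sub>2 h\<^sub>2 x \<tau> (hitting_time W {l\<^sub>1..l\<^sub>2}) \<le>
        payoff P W f\<^sub>2 g\<^sub>2 h\<^sub>2 x (hitting_time W {r..1}) (hitting_time W {l\<^sub>1..l\<^sub>2})))"
  have nash: "nash_equilibrium M G P W f\<^sub>1 g\<^sub>1 h\<^sub>1 f\<^sub>2 g\<^sub>2 h\<^sub>2 (hitting_time W {l\<^sub>1..l\<^sub>2}, hitting_time W {r..1}) \<longleftrightarrow> best"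
    unfolding nash_equilibrium_def case_prod_conv best_response_iff[OF stop(1)] best_response_iff[OF stop(2)] best_def
    using stop by blast
  have util: "utility P W f\<^sub>1 g\<^sub>1 f\<^sub>2 g\<^sub>2 2 s \<ge> 0 \<longleftrightarrow> g\<^sub>1 r / r * l\<^sub>2 \<le> f\<^sub>1 l\<^sub>2"
    unfolding utility_eq(2)[OF s] lr[symmetric] using more_order(7)
    by (simp add: zero_le_divide_iff)
  have "best" if nonneg: "g\<^sub>1 r / r * l\<^sub>2 \<le> f\<^sub>1 l\<^sub>2"
    unfolding best_def
  proof (intro ballI conjI)
    fix x \<tau> assume x: "x \<in> {0<..<1::real}" and \<tau>: "\<tau> \<in> stopping_times M G P"
    show "payoff P W f\<^sub>1 g\<^sub>1 h\<^sub>1 x \<tau> (hitting_time W {r..1}) \<le>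
        payoff P W f\<^sub>1 g\<^sub>1 h\<^sub>1 x (hitting_time W {l\<^sub>1..l\<^sub>2}) (hitting_time W {r..1})"
      by (rule first_player_best_response[OF adm\<^sub>1 order(1) lr_order(1-3) more_order(3) lr_order(5) f\<^sub>1 opt\<^sub>1 opt\<^sub>2 nonneg x \<tau>])
    show "payoff P W f\<^sub>2 g\<^sub>2 h\<^sub>2 x \<tau> (hitting_time W {l\<^sub>1..l\<^sub>2}) \<le>
        payoff P W f\<^sub>2 g\<^sub>2 h\<^sub>2 x (hitting_time W {r..1}) (hitting_time W {l\<^sub>1..l\<^sub>2})"
      by (rule second_player_best_response[OF adm\<^sub>2 more_order(1) lr_order(2) more_order(2) lr_order(4,5) f\<^sub>2 opt\<^sub>3 x \<tau>])
  qed
  moreover have "g\<^sub>1 r / r * l\<^sub>2 \<le> f\<^sub>1 l\<^sub>2" if best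
  proof -
    \<comment> \<open>Testing the equilibrium at the starting point \<open>l\<^sub>2\<close> against
      never stopping yields the sign condition, since stopping at once pays
      \<open>f\<^sub>1 l\<^sub>2\<close>.\<close>
    have "g\<^sub>1 r / r * l\<^sub>2 = payoff P W f\<^sub>1 g\<^sub>1 h\<^sub>1 l\<^sub>2 (hitting_time W {}) (hitting_time W {r..1})"
      by (rule payoff_never_stop_right[OF adm\<^sub>1, symmetric]) (use more_order lr_order in auto)
    also have "\<dots> \<le> payoff P W f\<^sub>1 g\<^sub>1 h\<^sub>1 l\<^sub>2 (hitting_time W {l\<^sub>1..l\<^sub>2}) (hitting_time W {r..1})"
      using that stop(3) more_order(4,5) unfolding best_def by simp
    also have "\<dots> = f\<^sub>1 l\<^sub>2 + 0 * l\<^sub>2"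
      by (rule payoff_hitting_times[OF adm\<^sub>1, where \<alpha>=l\<^sub>2 and \<beta>=l\<^sub>2])
        (use lr_order more_order in \<open>auto simp: absorbing_def\<close>)
    finally show ?thesis by simp
  qed
  ultimately show ?thesis unfolding util lr[symmetric] nash by blast
qed

end

end

theorem theorem6p1:
  fixes M :: "'a measure" and G :: "ennreal \<Rightarrow> 'a measure"
    and P :: "real \<Rightarrow> 'a measure" and W :: "real \<Rightarrow> 'a \<Rightarrow> real"
    and f\<^sub>1 g\<^sub>1 h\<^sub>1 f\<^sub>2 g\<^sub>2 h\<^sub>2 :: "real \<Rightarrow> real"
    and a\<^sub>1 a\<^sub>2 b :: real
  assumes "brownian_motion_family M G P W"
    and "admissible_rewards f\<^sub>1 g\<^sub>1 h\<^sub>1" and "admissible_rewards f\<^sub>2 g\<^sub>2 h\<^sub>2"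
    and "0 < a\<^sub>1" and "a\<^sub>1 \<le> a\<^sub>2" and "a\<^sub>2 < b" and "b < 1"
    and "convex_on {0..a\<^sub>1} f\<^sub>1" and "concave_on {a\<^sub>1..a\<^sub>2} f\<^sub>1" and "convex_on {a\<^sub>2..1} f\<^sub>1"
    and "convex_on {0..b} f\<^sub>2" and "concave_on {b..1} f\<^sub>2"
  shows "(\<exists>s. generalised_equilibrium (strategies a\<^sub>1 a\<^sub>2 b) (utility P W f\<^sub>1 g\<^sub>1 f\<^sub>2 g\<^sub>2) s) \<and>
    (\<forall>s. generalised_equilibrium (strategies a\<^sub>1 a\<^sub>2 b) (utility P W f\<^sub>1 g\<^sub>1 f\<^sub>2 g\<^sub>2) s \<longrightarrow>
      (utility P W f\<^sub>1 g\<^sub>1 f\<^sub>2 g\<^sub>2 2 s \<ge> 0 \<longleftrightarrow>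
       nash_equilibrium M G P W f\<^sub>1 g\<^sub>1 h\<^sub>1 f\<^sub>2 g\<^sub>2 h\<^sub>2
         (hitting_time W {s $ 1..s $ 2}, hitting_time W {s $ 3..1})))"
proof -
  interpret brownian_motion_family M G P W by (rule assms(1))
  show ?thesis
    using generalised_equilibrium_exists[OF assms(2-7) assms(9,12)]
      nash_iff_utility_nonneg[OF assms(2-12)] by blast
qed

end
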